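(* In the fixed-base chain setting of the context, with gravity, define recursively $\tilde{\mathbf{V}}_0=\mathbf{a}_g$, $\tilde{\mathbf{C}}_0=\mathbf{0}_{1\times10}$, and for $i=1,\ldots,N$: $$\tilde{\mathbf{V}}_i=\Big[\,\mathbf W_i,\ (\boldsymbol{\Phi}_i\times)\mathbf W_i,\ \ldots,\ (\boldsymbol{\Phi}_i\times)^5\mathbf W_i,\ \boldsymbol{\Phi}_i\Big],\quad \mathbf W_i={}^{J_i}\mathbf{X}_{i-1}\tilde{\mathbf{V}}_{i-1},$$ $$\mathbf{O}_i=\begin{bmatrix}\mathbf{D}_i\\ \mathbf{D}_i\mathbf{A}(\boldsymbol\Phi_i)\\ \vdots\\ \mathbf{D}_i\mathbf{A}(\boldsymbol\Phi_i)^{9}\end{bmatrix},\ \ \mathbf D_i=\tilde{\mathbf{C}}_{i-1}\mathbf{B}\big(({}^{J_i}\mathbf{X}_{i-1})^\top\big),\qquad \mathbf{N}_i=\begin{bmatrix}\mathbf{C}(\tilde{\mathbf{V}}_i,\boldsymbol{\Phi}_i)\\ \mathbf{O}_i\mathbf{A}(\boldsymbol{\Phi}_i)\end{bmatrix},\qquad \tilde{\mathbf{C}}_i=\begin{bmatrix}\mathbf{C}(\tilde{\mathbf{V}}_i,\boldsymbol{\Phi}_i)\\ \mathbf{O}_i\end{bmatrix}.$$ For $i=1,\ldots,N$ let $\mathcal{T}_i=\{\delta\boldsymbol{\pi}\in\mathbb{R}^{10N}:\ \mathbf{N}_i\delta\boldsymbol{\pi}_i=\mathbf{0},\ \delta\boldsymbol{\pi}_{i-1}=-\mathbf{B}(({}^{J_i}\mathbf{X}_{i-1})^\top)\delta\boldsymbol{\pi}_i\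 (\text{if } i\ge2),\ \delta\boldsymbol{\pi}_j=\mathbf{0}\text{ for } j\notin\{i,i-1\}\}$. Then the set $\mathcal{N}_g$ of parameter changes $\delta\boldsymbol\pi$ that leave both the kinetic energy and the generalized gravitational force unchanged for all states, i.e. such that for all $\mathbf q,\dot{\mathbf q}\in\mathbb R^N$ $$\sum_{j=1}^N\mathbf{v}_j^\top[\delta\boldsymbol\pi_j]^\wedge\mathbf{v}_j=0\quad\text{and}\quad \sum_{j=1}^N\mathbf{v}_j^\top[\delta\boldsymbol\pi_j]^\wedge\,{}^{j}\mathbf{X}_0(\mathbf q)\,\mathbf{a}_g=0,$$ satisfies $\mathcal{N}_g=\bigoplus_{i=1}^N\mathcal{T}_i$.
   Context: Spatial notation. For $\mathbf{x}\in\mathbb{R}^3$, $\mathbf{S}(\mathbf{x})$ is the skew-symmetric matrix with $\mathbf{S}(\mathbf{x})\mathbf{y}=\mathbf{x}\times\mathbf{y}$. For $\mathbf{v}=[\boldsymbol{\omega};\mathbf{u}]\in\mathbb{R}^6$, $(\mathbf{v}\times)=\begin{bmatrix}\mathbf{S}(\boldsymbol{\omega})&\mathbf{0}\\ \mathbf{S}(\mathbf{u})&\mathbf{S}(\boldsymbol{\omega})\end{bmatrix}$. A spatial transform is a matrix $\begin{bmatrix}\mathbf{R}&\mathbf{0}\\-\mathbf{R}\mathbf{S}(\mathbf{p})&\mathbf{R}\end{bmatrix}$ with $\mathbf{R}\in SO(3)$, $\mathbf{p}\in\mathbb{R}^3$. Inertial parameters $\boldsymbol{\pi}=[m,h_x,h_y,h_z,I_{xx},I_{xy},I_{xz},I_{yy},I_{yz},I_{zz}]^\top\in\mathbb{R}^{10}$;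 $[\boldsymbol{\pi}]^{\wedge}=\begin{bmatrix}\bar{\mathbf{I}}&\mathbf{S}(\mathbf{h})\\ \mathbf{S}(\mathbf{h})^{\top}&m\mathbf{1}_3\end{bmatrix}$ with $\mathbf{h}=[h_x,h_y,h_z]^\top$, $\bar{\mathbf{I}}$ the symmetric $3\times3$ matrix with entries $I_{xx},I_{xy},\ldots$; $[\cdot]^{\vee}$ is its inverse on the 10-dimensional space of such matrices. $\mathbf{A}(\boldsymbol{\Phi})\boldsymbol{\pi}=\big[(\boldsymbol{\Phi}\times)^\top[\boldsymbol{\pi}]^\wedge+[\boldsymbol{\pi}]^\wedge(\boldsymbol{\Phi}\times)\big]^\vee$; for a spatial transform $\mathbf X$, $\mathbf{B}(\mathbf{X}^\top)\boldsymbol{\pi}=\big[\mathbf{X}^\top[\boldsymbol{\pi}]^\wedge\mathbf{X}\big]^\vee$; for $\mathbf{V}\in\mathbb{R}^{6\times k}$, $\mathbf{C}(\mathbf{V},\boldsymbol{\Phi})\in\mathbb R^{k\times 10}$ satisfies $\mathbf{C}(\mathbf{V},\boldsymbol{\Phi})\boldsymbol{\pi}=\mathbf{V}^\top[\boldsymbol{\pi}]^\wedge\boldsymbol{\Phi}$. Fixed-base chain. Body $0$ is the fixed ground with $\mathbf{v}_0=\mathbf{0}$. For $i=1,\ldots,N$, joint $i$ has coordinate $q_i$ and $\mathbf{v}_i={}^{i}\mathbf{X}_{i-1}(q_i)\mathbf{v}_{i-1}+\boldsymbol{\Phi}_i\dot q_i$, with $\boldsymbol{\Phi}_i\in\mathbb{R}^6$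 fixed, ${}^{i}\mathbf{X}_{i-1}(q_i)={}^{i}\mathbf{X}_{J_i}(q_i)\,{}^{J_i}\mathbf{X}_{i-1}$, ${}^{J_i}\mathbf{X}_{i-1}$ constant, ${}^{i}\mathbf{X}_{J_i}(0)=\mathbf{1}_6$, $\frac{d}{dq_i}{}^{i}\mathbf{X}_{J_i}(q_i)=-(\boldsymbol{\Phi}_i\times){}^{i}\mathbf{X}_{J_i}(q_i)$. ${}^{j}\mathbf{X}_0(\mathbf q)={}^{j}\mathbf{X}_{j-1}(q_j)\cdots{}^{1}\mathbf{X}_0(q_1)$. $\mathbf{a}_g\in\mathbb{R}^6$ is the spatial gravitational acceleration expressed in ground coordinates (zero angular part). The second displayed condition is equivalent to the variation of the generalized gravity force vanishing identically; together the two conditions characterize the parameter changes $\delta\boldsymbol\pi$ invisible to the inverse dynamics with gravity, i.e. $\mathbf Y(\mathbf q,\dot{\mathbf q},\ddot{\mathbf q})\delta\boldsymbol\pi=\mathbf 0$ for all states. *)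

theory Defs
  imports "HOL-Analysis.Analysis"
begin

section \<open>Splitting spatial vectors R^6 = R^3 x R^3 (angular part first)\<close>

definition lo :: "3 \<Rightarrow> 6" where
  "lo k = (if k = 1 then 1 else if k = 2 then 2 else 3)"
definition hi :: "3 \<Rightarrow> 6" where
  "hi k = (if k = 1 then 4 else if k = 2 then 5 else 6)"

definition topv :: "real^6 \<Rightarrow> real^3" where "topv v = (\<chi> k. v $ lo k)"
definition botv :: "real^6 \<Rightarrow> real^3" where "botv v = (\<chi> k. v $ hi k)"

definition sv :: "real^3 \<Rightarrow> real^3 \<Rightarrow> real^6" where
  "sv w u = (\<chi> i. if i = 1 then w$1 else if i = 2 then w$2 else if i = 3 then w$3
                  else if i = 4 then u$1 else if i = 5 then u$2 else u$3)"

text \<open>Block matrix [P Q; R T] acting on [w; u].\<close>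
definition blk :: "real^3^3 \<Rightarrow> real^3^3 \<Rightarrow> real^3^3 \<Rightarrow> real^3^3 \<Rightarrow> real^6^6" where
  "blk P Q R T = matrix (\<lambda>v. sv (P *v topv v + Q *v botv v) (R *v topv v + T *v botv v))"

section \<open>Skew matrix, spatial cross product, spatial transforms\<close>

definition skew :: "real^3 \<Rightarrow> real^3^3" where
  "skew x = matrix (\<lambda>y. cross3 x y)"

definition scross :: "real^6 \<Rightarrow> real^6^6" where
  "scross v = blk (skew (topv v)) 0 (skew (botv v)) (skew (topv v))"

definition SO3 :: "(real^3^3) set" where
  "SO3 = {R. orthogonal_matrix R \<and> det R = 1}"

definition is_stransform :: "real^6^6 \<Rightarrow> bool" where
  "is_stransform X \<longleftrightarrow> (\<exists>R p. R \<in> SO3 \<and> X = blk R 0 (- (R ** skew p)) R)"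

section \<open>Inertial parameters: hat and vee maps\<close>

text \<open>pi = [m, hx, hy, hz, Ixx, Ixy, Ixz, Iyy, Iyz, Izz] at indices 1..10 (10 = 0 in type 10).\<close>

definition hvec :: "real^10 \<Rightarrow> real^3" where
  "hvec p = (\<chi> k. if k = 1 then p$2 else if k = 2 then p$3 else p$4)"

definition Ibar :: "real^10 \<Rightarrow> real^3^3" where
  "Ibar p = (\<chi> i j.
     if i = 1 \<and> j = 1 then p$5
     else if (i = 1 \<and> j = 2) \<or> (i = 2 \<and> j = 1) then p$6
     else if (i = 1 \<and> j = 3) \<or> (i = 3 \<and> j = 1) then p$7
     else if i = 2 \<and> j = 2 then p$8
     else if (i = 2 \<and> j = 3) \<or> (i = 3 \<and> j = 2) then p$9
     else p$10)"

definition hat :: "real^10 \<Rightarrow> real^6^6" where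
  "hat p = blk (Ibar p) (skew (hvec p)) (transpose (skew (hvec p))) (p$1 *\<^sub>R mat 1)"

text \<open>Inverse of hat on the 10-dimensional space of such matrices (reads off the entries).\<close>
definition vee :: "real^6^6 \<Rightarrow> real^10" where
  "vee M = (\<chi> k. if k = 1 then M$4$4
               else if k = 2 then M$3$5
               else if k = 3 then M$1$6
               else if k = 4 then M$2$4
               else if k = 5 then M$1$1
               else if k = 6 then M$1$2
               else if k = 7 then M$1$3
               else if k = 8 then M$2$2
               else if k = 9 then M$2$3
               else M$3$3)"

section \<open>The matrices A, B, C\<close>

definition Amat :: "real^6 \<Rightarrow> real^10^10" where
  "Amat Phi = matrix (\<lambda>p. vee (transpose (scross Phi) ** hat p + hat p ** scross Phi))"

text \<open>B(M) p = [M hat(p) M^T]^vee; used as B(X^T) p = [X^T hat(p) X]^vee.\<close>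
definition Bmat :: "real^6^6 \<Rightarrow> real^10^10" where
  "Bmat M = matrix (\<lambda>p. vee (M ** hat p ** transpose M))"

text \<open>A k x 10 matrix is represented by the list of its rows; a 6 x k matrix by the list of its columns.
  C(V,Phi): row for column c of V is the functional p |-> c^T hat(p) Phi.\<close>
definition Cmat :: "(real^6) list \<Rightarrow> real^6 \<Rightarrow> (real^10) list" where
  "Cmat V Phi = map (\<lambda>c. \<chi> k. c \<bullet> (hat (axis k 1) *v Phi)) V"

section \<open>Fixed-base chain\<close>

text \<open>XJ i q = iX_{J_i}(q), XJ0 i = J_iX_{i-1}, Phi i, q/qd :: nat => real (indices 1..N).\<close>

fun vel :: "(nat \<Rightarrow> real \<Rightarrow> real^6^6) \<Rightarrow> (nat \<Rightarrow> real^6^6) \<Rightarrow> (nat \<Rightarrow> real^6)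
            \<Rightarrow> (nat \<Rightarrow> real) \<Rightarrow> (nat \<Rightarrow> real) \<Rightarrow> nat \<Rightarrow> real^6" where
  "vel XJ XJ0 Phi q qd 0 = 0"
| "vel XJ XJ0 Phi q qd (Suc i) =
     (XJ (Suc i) (q (Suc i)) ** XJ0 (Suc i)) *v vel XJ XJ0 Phi q qd i + qd (Suc i) *\<^sub>R Phi (Suc i)"

fun Xto0 :: "(nat \<Rightarrow> real \<Rightarrow> real^6^6) \<Rightarrow> (nat \<Rightarrow> real^6^6) \<Rightarrow> (nat \<Rightarrow> real) \<Rightarrow> nat \<Rightarrow> real^6^6" where
  "Xto0 XJ XJ0 q 0 = mat 1"
| "Xto0 XJ XJ0 q (Suc j) = (XJ (Suc j) (q (Suc j)) ** XJ0 (Suc j)) ** Xto0 XJ XJ0 q j"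

section \<open>The recursion for tilde V, tilde C, O, N\<close>

fun Vt :: "(nat \<Rightarrow> real^6^6) \<Rightarrow> (nat \<Rightarrow> real^6) \<Rightarrow> real^6 \<Rightarrow> nat \<Rightarrow> (real^6) list" where
  "Vt XJ0 Phi ag 0 = [ag]"
| "Vt XJ0 Phi ag (Suc i) =
     (let W = map (\<lambda>c. XJ0 (Suc i) *v c) (Vt XJ0 Phi ag i)
      in concat (map (\<lambda>k. map (\<lambda>c. (((*v) (scross (Phi (Suc i)))) ^^ k) c) W) [0..<6])
         @ [Phi (Suc i)])"

definition Dmat :: "(nat \<Rightarrow> real^6^6) \<Rightarrow> (real^10) list \<Rightarrow> nat \<Rightarrow> (real^10) list" where
  "Dmat XJ0 Cprev i = map (\<lambda>r. r v* Bmat (transpose (XJ0 i))) Cprev"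

definition Omat :: "(nat \<Rightarrow> real^6^6) \<Rightarrow> (nat \<Rightarrow> real^6) \<Rightarrow> (real^10) list \<Rightarrow> nat \<Rightarrow> (real^10) list" where
  "Omat XJ0 Phi Cprev i =
     concat (map (\<lambda>k. map (\<lambda>r. ((\<lambda>x. x v* Amat (Phi i)) ^^ k) r) (Dmat XJ0 Cprev i)) [0..<10])"

fun Ct :: "(nat \<Rightarrow> real^6^6) \<Rightarrow> (nat \<Rightarrow> real^6) \<Rightarrow> real^6 \<Rightarrow> nat \<Rightarrow> (real^10) list" where
  "Ct XJ0 Phi ag 0 = [0]"
| "Ct XJ0 Phi ag (Suc i) =
     Cmat (Vt XJ0 Phi ag (Suc i)) (Phi (Suc i)) @ Omat XJ0 Phi (Ct XJ0 Phi ag i) (Suc i)"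

definition Nmat :: "(nat \<Rightarrow> real^6^6) \<Rightarrow> (nat \<Rightarrow> real^6) \<Rightarrow> real^6 \<Rightarrow> nat \<Rightarrow> (real^10) list" where
  "Nmat XJ0 Phi ag i =
     Cmat (Vt XJ0 Phi ag i) (Phi i)
     @ map (\<lambda>r. r v* Amat (Phi i)) (Omat XJ0 Phi (Ct XJ0 Phi ag (i - 1)) i)"

section \<open>Parameter space R^{10N}, the sets T_i and N_g\<close>

text \<open>delta-pi in R^{10N} is a map nat => real^10 vanishing outside {1..N}.\<close>
definition Pspace :: "nat \<Rightarrow> (nat \<Rightarrow> real^10) set" where
  "Pspace N = {dp. \<forall>j. j \<notin> {1..N} \<longrightarrow> dp j = 0}"

definition Tset :: "nat \<Rightarrow> (nat \<Rightarrow> real^6^6) \<Rightarrow> (nat \<Rightarrow> real^6) \<Rightarrow> real^6 \<Rightarrow> nat \<Rightarrow> (nat \<Rightarrow> real^10) set" where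
  "Tset N XJ0 Phi ag i = {dp \<in> Pspace N.
      (\<forall>r \<in> set (Nmat XJ0 Phi ag i). r \<bullet> dp i = 0)
    \<and> (i \<ge> 2 \<longrightarrow> dp (i - 1) = - (Bmat (transpose (XJ0 i)) *v dp i))
    \<and> (\<forall>j. j \<noteq> i \<and> j \<noteq> i - 1 \<longrightarrow> dp j = 0)}"

definition Ngset :: "nat \<Rightarrow> (nat \<Rightarrow> real \<Rightarrow> real^6^6) \<Rightarrow> (nat \<Rightarrow> real^6^6) \<Rightarrow> (nat \<Rightarrow> real^6) \<Rightarrow> real^6
                     \<Rightarrow> (nat \<Rightarrow> real^10) set" where
  "Ngset N XJ XJ0 Phi ag = {dp \<in> Pspace N. \<forall>q qd.
      (\<Sum>j=1..N. vel XJ XJ0 Phi q qd j \<bullet> (hat (dp j) *v vel XJ XJ0 Phi q qd j)) = 0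
    \<and> (\<Sum>j=1..N. vel XJ XJ0 Phi q qd j \<bullet> (hat (dp j) *v (Xto0 XJ XJ0 q j *v ag))) = 0}"

text \<open>Internal direct sum of the family T_1..T_N equal to a set S.\<close>
definition is_direct_sum :: "(nat \<Rightarrow> real^10) set \<Rightarrow> nat \<Rightarrow> (nat \<Rightarrow> (nat \<Rightarrow> real^10) set) \<Rightarrow> bool" where
  "is_direct_sum S N T \<longleftrightarrow>
     S = {(\<lambda>j. \<Sum>i=1..N. t i j) | t. \<forall>i\<in>{1..N}. t i \<in> T i}
   \<and> (\<forall>t. (\<forall>i\<in>{1..N}. t i \<in> T i) \<and> (\<lambda>j. \<Sum>i=1..N. t i j) = (\<lambda>j. 0)
          \<longrightarrow> (\<forall>i\<in>{1..N}. t i = (\<lambda>j. 0)))"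

end

theory Submission
  imports Defs
begin

text \<open>
  Write \<open>v\<^sub>i = X\<^sub>i(q\<^sub>i) (\<^sup>JX\<^sub>i\<^sub>-\<^sub>1 v\<^sub>i\<^sub>-\<^sub>1) + q\<^sub>i' \<Phi>\<^sub>i\<close>, where the joint transform
  \<open>X\<^sub>i(s)\<close> is the flow of the linear ODE \<open>X' = -(\<Phi>\<^sub>i\<times>) X\<close> and hence commutes with \<open>\<Phi>\<^sub>i\<times>\<close>.
  A parameter change of the shape of \<open>T\<^sub>i\<close> (value \<open>x\<close> on body \<open>i\<close>, \<open>-B x\<close> on body \<open>i-1\<close>)
  changes the kinetic and gravity terms by a residual that only involves bodies \<open>i-1\<close> and \<open>i\<close>
  and vanishes at \<open>q\<^sub>i = q\<^sub>i' = 0\<close>. Every \<open>\<delta>\<pi>\<close> is a unique sum of such changes, and if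
  \<open>\<delta>\<pi> \<in> N\<^sub>g\<close> the residuals sum to zero; freezing the joints from the tip of the chain
  downwards shows that each residual vanishes separately.

  A residual is a polynomial in \<open>q\<^sub>i'\<close> whose coefficients are linear functionals evaluated
  along the flows \<open>s \<mapsto> X\<^sub>i(s) w\<close> and \<open>s \<mapsto> B(X\<^sub>i(s)\<^sup>T) y\<close>, the latter solving
  \<open>y' = -A(\<Phi>\<^sub>i) y\<close>. A linear functional vanishes along the solution of a linear ODE iff it
  vanishes on the Krylov vectors \<open>L\<^sup>k z\<close>, \<open>k < dim\<close>; this turns the conditions on all states
  into the finitely many rows of \<open>Vt\<close>, \<open>Ct\<close>, \<open>Omat\<close> and \<open>Nmat\<close>.
\<close>

section \<open>Spatial vectors and 6\<times>6 block matrices\<close>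

lemma exhaust_6:
  fixes x :: 6
  shows "x = 1 \<or> x = 2 \<or> x = 3 \<or> x = 4 \<or> x = 5 \<or> x = 6"
proof (induct x)
  case (of_int z)
  then have "z = 0 \<or> z = 1 \<or> z = 2 \<or> z = 3 \<or> z = 4 \<or> z = 5" by fastforce
  then show ?case by auto
qed

lemma exhaust_10:
  fixes x :: 10
  shows "x = 1 \<or> x = 2 \<or> x = 3 \<or> x = 4 \<or> x = 5 \<or> x = 6 \<or> x = 7 \<or> x = 8 \<or> x = 9 \<or> x = 10"
proof (induct x)
  case (of_int z)
  then have "z = 0 \<or> z = 1 \<or> z = 2 \<or> z = 3 \<or> z = 4 \<or> z = 5 \<or> z = 6 \<or> z = 7 \<or> z = 8 \<or> z = 9"
    by simp presburger
  then show ?case by auto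
qed

lemma lo_simps [simp]: "lo 1 = 1" "lo 2 = 2" "lo 3 = 3" by (simp_all add: lo_def)
lemma hi_simps [simp]: "hi 1 = 4" "hi 2 = 5" "hi 3 = 6" by (simp_all add: hi_def)

lemma lo_or_hi: "(i::6) \<in> range lo \<or> i \<in> range hi"
  using exhaust_6[of i] by (metis lo_simps hi_simps rangeI)

lemma lo_eq_iff [simp]: "lo a = lo b \<longleftrightarrow> a = b"
  using exhaust_3[of a] exhaust_3[of b] by auto
lemma hi_eq_iff [simp]: "hi a = hi b \<longleftrightarrow> a = b"
  using exhaust_3[of a] exhaust_3[of b] by auto
lemma lo_neq_hi [simp]: "lo a \<noteq> hi b" "hi b \<noteq> lo a"
  using exhaust_3[of a] exhaust_3[of b] by auto

lemma sv_nth_lo [simp]: "sv w u $ lo k = w $ k"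
  using exhaust_3[of k] by (auto simp: sv_def)
lemma sv_nth_hi [simp]: "sv w u $ hi k = u $ k"
  using exhaust_3[of k] by (auto simp: sv_def)

lemma topv_sv [simp]: "topv (sv w u) = w" by (simp add: topv_def vec_eq_iff)
lemma botv_sv [simp]: "botv (sv w u) = u" by (simp add: botv_def vec_eq_iff)
lemma topv_nth [simp]: "topv v $ k = v $ lo k" by (simp add: topv_def)
lemma botv_nth [simp]: "botv v $ k = v $ hi k" by (simp add: botv_def)

lemma vec6_eqI: "(\<And>k. (v::'a^6) $ lo k = w $ lo k) \<Longrightarrow> (\<And>k. v $ hi k = w $ hi k) \<Longrightarrow> v = w"
  by (metis lo_or_hi imageE vec_eq_iff)

lemma sv_add: "sv w u + sv w' u' = sv (w + w') (u + u')"
  by (rule vec6_eqI) auto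
lemma sv_scaleR: "c *\<^sub>R sv w u = sv (c *\<^sub>R w) (c *\<^sub>R u)"
  by (rule vec6_eqI) auto
lemma topv_add: "topv (v + w) = topv v + topv w" by (simp add: vec_eq_iff)
lemma botv_add: "botv (v + w) = botv v + botv w" by (simp add: vec_eq_iff)
lemma topv_scaleR: "topv (c *\<^sub>R v) = c *\<^sub>R topv v" by (simp add: vec_eq_iff)
lemma botv_scaleR: "botv (c *\<^sub>R v) = c *\<^sub>R botv v" by (simp add: vec_eq_iff)

lemma matrix_add_rdistrib: "((A::real^'n^'m) + B) ** (C::real^'p^'n) = A ** C + B ** C"
  by (simp add: matrix_matrix_mult_def vec_eq_iff sum.distrib algebra_simps)
lemma matrix_neg_left: "(- (A::real^'n^'m)) ** (C::real^'p^'n) = - (A ** C)"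
  by (simp add: matrix_matrix_mult_def vec_eq_iff sum_negf)
lemma matrix_neg_right: "(A::real^'n^'m) ** (- (C::real^'p^'n)) = - (A ** C)"
  by (simp add: matrix_matrix_mult_def vec_eq_iff sum_negf)
lemma matrix_diff_rdistrib: "((A::real^'n^'m) - B) ** (C::real^'p^'n) = A ** C - B ** C"
  by (simp add: matrix_matrix_mult_def vec_eq_iff sum_subtractf algebra_simps)
lemma matrix_diff_ldistrib: "(C::real^'n^'m) ** ((A::real^'p^'n) - B) = C ** A - C ** B"
  by (simp add: matrix_matrix_mult_def vec_eq_iff sum_subtractf algebra_simps)
lemma matrix_scaleR_left: "(c *\<^sub>R (A::real^'n^'m)) ** (C::real^'p^'n) = c *\<^sub>R (A ** C)"
  by (simp add: scalar_matrix_assoc)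
lemma matrix_scaleR_right: "(A::real^'n^'m) ** (c *\<^sub>R (C::real^'p^'n)) = c *\<^sub>R (A ** C)"
  by (simp add: matrix_scalar_ac scalar_matrix_assoc)
lemma transpose_add: "transpose ((A::real^'n^'m) + B) = transpose A + transpose B"
  by (simp add: transpose_def vec_eq_iff)
lemma transpose_uminus: "transpose (- (A::real^'n^'m)) = - transpose A"
  by (simp add: transpose_def vec_eq_iff)
lemma transpose_diff: "transpose ((A::real^'n^'m) - B) = transpose A - transpose B"
  by (simp add: transpose_def vec_eq_iff)
lemma transpose_zero: "transpose (0::real^'n^'m) = 0"
  by (simp add: transpose_def vec_eq_iff)
lemma matrix_vector_mult_uminus: "(- (A::real^'n^'m)) *v x = - (A *v x)"
  by (simp add: matrix_vector_mult_def vec_eq_iff sum_negf)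
lemma matrix_vector_mult_scaleR_left: "(c *\<^sub>R (A::real^'n^'m)) *v x = c *\<^sub>R (A *v x)"
  by (simp add: matrix_vector_mult_def vec_eq_iff sum_distrib_left mult.assoc)

lemma scaleR_mat1_mult: "(c *\<^sub>R mat 1 :: real^'n^'n) ** A = c *\<^sub>R A"
  by (simp add: matrix_scaleR_left)
lemma mult_scaleR_mat1: "A ** (c *\<^sub>R mat 1 :: real^'n^'n) = c *\<^sub>R A"
  by (simp add: matrix_scaleR_right)

lemmas matrix_simps = matrix_add_rdistrib matrix_add_ldistrib matrix_neg_left matrix_neg_right
  matrix_diff_rdistrib matrix_diff_ldistrib matrix_scaleR_left matrix_scaleR_right
  transpose_add transpose_uminus transpose_diff transpose_zero transpose_scalar matrix_transpose_mul

lemma linear_blk_fun: "linear (\<lambda>v. sv (P *v topv v + Q *v botv v) (R *v topv v + T *v botv v))"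
  by (rule linearI) (simp_all add: sv_add sv_scaleR topv_add botv_add topv_scaleR botv_scaleR
      matrix_vector_right_distrib matrix_vector_mult_scaleR algebra_simps)

lemma blk_mult_vec: "blk P Q R T *v v = sv (P *v topv v + Q *v botv v) (R *v topv v + T *v botv v)"
  unfolding blk_def using matrix_vector_mul(2)[OF linear_blk_fun] by metis

lemma blk_mult: "blk P Q R T ** blk P' Q' R' T' =
   blk (P**P' + Q**R') (P**Q' + Q**T') (R**P' + T**R') (R**Q' + T**T')"
  unfolding matrix_eq
  by (simp add: matrix_vector_mul_assoc[symmetric] blk_mult_vec matrix_vector_right_distrib
      matrix_vector_mult_add_rdistrib algebra_simps)

lemma matrix_nth_eq_mult_axis: "(M::real^'n^'m) $ i $ j = (M *v axis j 1) $ i"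
  by (simp add: matrix_vector_mult_def axis_def if_distrib if_distribR cong: if_cong)

lemma topv_axis_lo [simp]: "topv (axis (lo b) 1) = axis b 1" by (simp add: vec_eq_iff axis_def)
lemma botv_axis_lo [simp]: "botv (axis (lo b) 1) = 0" by (simp add: vec_eq_iff axis_def)
lemma topv_axis_hi [simp]: "topv (axis (hi b) 1) = 0" by (simp add: vec_eq_iff axis_def)
lemma botv_axis_hi [simp]: "botv (axis (hi b) 1) = axis b 1" by (simp add: vec_eq_iff axis_def)

lemma blk_nth [simp]:
  "blk P Q R T $ lo a $ lo b = P $ a $ b"
  "blk P Q R T $ lo a $ hi b = Q $ a $ b"
  "blk P Q R T $ hi a $ lo b = R $ a $ b"
  "blk P Q R T $ hi a $ hi b = T $ a $ b"
  by (simp_all add: matrix_nth_eq_mult_axis[of "blk P Q R T"] blk_mult_vec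
      matrix_nth_eq_mult_axis[symmetric])

lemma mat6_eqI:
  assumes "\<And>a b. (M::real^6^6) $ lo a $ lo b = M' $ lo a $ lo b"
    "\<And>a b. M $ lo a $ hi b = M' $ lo a $ hi b"
    "\<And>a b. M $ hi a $ lo b = M' $ hi a $ lo b"
    "\<And>a b. M $ hi a $ hi b = M' $ hi a $ hi b"
  shows "M = M'"
proof -
  have "M $ i $ j = M' $ i $ j" for i j
    using lo_or_hi[of i] lo_or_hi[of j] assms by auto
  then show ?thesis by (simp add: vec_eq_iff)
qed

lemma blk_eq_iff: "blk P Q R T = blk P' Q' R' T' \<longleftrightarrow> P = P' \<and> Q = Q' \<and> R = R' \<and> T = T'"
proof
  assume "blk P Q R T = blk P' Q' R' T'"
  then show "P = P' \<and> Q = Q' \<and> R = R' \<and> T = T'"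
    by (simp add: vec_eq_iff) (metis blk_nth)
qed auto

lemma transpose_blk: "transpose (blk P Q R T) = blk (transpose P) (transpose R) (transpose Q) (transpose T)"
  by (rule mat6_eqI) (simp_all add: transpose_def)

lemma blk_add: "blk P Q R T + blk P' Q' R' T' = blk (P + P') (Q + Q') (R + R') (T + T')"
  by (rule mat6_eqI) simp_all
lemma blk_uminus: "- blk P Q R T = blk (- P) (- Q) (- R) (- T)"
  by (rule mat6_eqI) simp_all
lemma blk_diff: "blk P Q R T - blk P' Q' R' T' = blk (P - P') (Q - Q') (R - R') (T - T')"
  by (rule mat6_eqI) simp_all
lemma blk_scaleR: "c *\<^sub>R blk P Q R T = blk (c *\<^sub>R P) (c *\<^sub>R Q) (c *\<^sub>R R) (c *\<^sub>R T)"
  by (rule mat6_eqI) simp_all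

lemmas blk_simps = blk_mult transpose_blk blk_add blk_uminus blk_diff blk_scaleR blk_eq_iff

section \<open>Skew matrices and the hat map\<close>

lemma linear_cross3_right: "linear (cross3 x)"
  by (rule linearI) (simp_all add: cross_add_right cross_mult_right)

lemma skew_mult_vec: "skew x *v y = cross3 x y"
  unfolding skew_def using matrix_vector_mul(2)[OF linear_cross3_right] by metis

lemma skew_nth [simp]:
  "skew x $ 1 $ 1 = 0" "skew x $ 1 $ 2 = - x$3" "skew x $ 1 $ 3 = x$2"
  "skew x $ 2 $ 1 = x$3" "skew x $ 2 $ 2 = 0" "skew x $ 2 $ 3 = - x$1"
  "skew x $ 3 $ 1 = - x$2" "skew x $ 3 $ 2 = x$1" "skew x $ 3 $ 3 = 0"
  by (simp_all add: matrix_nth_eq_mult_axis[of "skew x"] skew_mult_vec cross_components axis_def)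

lemma mat3_eqI:
  assumes "\<And>a b. a \<in> {1,2,3} \<Longrightarrow> b \<in> {1,2,3} \<Longrightarrow> (M::real^3^3) $ a $ b = M' $ a $ b"
  shows "M = M'"
proof -
  have "M $ a $ b = M' $ a $ b" for a b
    using exhaust_3[of a] exhaust_3[of b] assms by auto
  then show ?thesis by (simp add: vec_eq_iff)
qed

lemma transpose_skew: "transpose (skew x) = - skew x"
  by (rule mat3_eqI) (auto simp: transpose_def)

lemma skew_add: "skew (x + y) = skew x + skew y"
  by (rule mat3_eqI) auto
lemma skew_scaleR: "skew (c *\<^sub>R x) = c *\<^sub>R skew x"
  by (rule mat3_eqI) auto

lemma skew_of_antisymmetric:
  assumes "transpose Q = - (Q::real^3^3)"
  shows "Q = skew (vector [Q$3$2, Q$1$3, Q$2$1])"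
proof -
  have anti: "Q $ b $ a = - Q $ a $ b" for a b
  proof -
    have "transpose Q $ b $ a = (- Q) $ b $ a" using assms by simp
    then show ?thesis by (simp add: transpose_def)
  qed
  have diag: "Q $ a $ a = 0" for a using anti[of a a] by linarith
  show ?thesis
    using anti[of 1 2] anti[of 1 3] anti[of 2 3] by (intro mat3_eqI) (auto simp: diag vector_def)
qed

lemma vee_blk:
  "vee (blk P Q R T) = (\<chi> k. if k = 1 then T$1$1
               else if k = 2 then Q$3$2
               else if k = 3 then Q$1$3
               else if k = 4 then Q$2$1
               else if k = 5 then P$1$1
               else if k = 6 then P$1$2
               else if k = 7 then P$1$3
               else if k = 8 then P$2$2
               else if k = 9 then P$2$3
               else P$3$3)"
proof -
  have "blk P Q R T $ 4 $ 4 = T$1$1" "blk P Q R T $ 3 $ 5 = Q$3$2" "blk P Q R T $ 1 $ 6 = Q$1$3"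
    "blk P Q R T $ 2 $ 4 = Q$2$1" "blk P Q R T $ 1 $ 1 = P$1$1" "blk P Q R T $ 1 $ 2 = P$1$2"
    "blk P Q R T $ 1 $ 3 = P$1$3" "blk P Q R T $ 2 $ 2 = P$2$2" "blk P Q R T $ 2 $ 3 = P$2$3"
    "blk P Q R T $ 3 $ 3 = P$3$3"
    using blk_nth(4)[of P Q R T 1 1] blk_nth(2)[of P Q R T 3 2] blk_nth(2)[of P Q R T 1 3]
      blk_nth(2)[of P Q R T 2 1] blk_nth(1)[of P Q R T 1 1] blk_nth(1)[of P Q R T 1 2]
      blk_nth(1)[of P Q R T 1 3] blk_nth(1)[of P Q R T 2 2] blk_nth(1)[of P Q R T 2 3]
      blk_nth(1)[of P Q R T 3 3]
    by (simp_all only: lo_simps hi_simps)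
  then show ?thesis unfolding vee_def by (simp only:)
qed

lemma vec10_eqI:
  assumes "\<And>k. k \<in> {1,2,3,4,5,6,7,8,9,10} \<Longrightarrow> (v::real^10) $ k = w $ k"
  shows "v = w"
proof -
  have "v $ k = w $ k" for k
    using exhaust_10[of k] assms[of k] by blast
  then show ?thesis by (simp add: vec_eq_iff)
qed

lemma Ibar_nth [simp]:
  "Ibar p $ 1 $ 1 = p$5" "Ibar p $ 1 $ 2 = p$6" "Ibar p $ 1 $ 3 = p$7"
  "Ibar p $ 2 $ 1 = p$6" "Ibar p $ 2 $ 2 = p$8" "Ibar p $ 2 $ 3 = p$9"
  "Ibar p $ 3 $ 1 = p$7" "Ibar p $ 3 $ 2 = p$9" "Ibar p $ 3 $ 3 = p$10"
  by (simp_all add: Ibar_def)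

lemma hvec_nth [simp]: "hvec p $ 1 = p$2" "hvec p $ 2 = p$3" "hvec p $ 3 = p$4"
  by (simp_all add: hvec_def)

lemma vee_hat [simp]: "vee (hat p) = p"
  by (rule vec10_eqI) (auto simp: hat_def vee_blk mat_def)

lemma hat_inj: "hat p = hat q \<longleftrightarrow> p = q"
  by (metis vee_hat)

lemma hat_vee: "M \<in> range hat \<Longrightarrow> hat (vee M) = M"
  by auto

lemma blk_in_range_hat:
  assumes P: "transpose P = P" and Q: "transpose Q = - Q" and R: "R = transpose Q"
  shows "blk P Q R (c *\<^sub>R mat 1) \<in> range hat"
proof -
  let ?M = "blk P Q (transpose Q) (c *\<^sub>R mat 1)"
  have P_sym: "P $ b $ a = P $ a $ b" for a b
  proof -
    have "transpose P $ a $ b = P $ a $ b" using P by simp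
    then show ?thesis by (simp add: transpose_def)
  qed
  have "hvec (vee ?M) = vector [Q$3$2, Q$1$3, Q$2$1]"
    by (simp add: vec_eq_iff forall_3 vee_blk vector_def)
  then have skew: "skew (hvec (vee ?M)) = Q"
    using skew_of_antisymmetric[OF Q] by simp
  have Ibar: "Ibar (vee ?M) = P"
    by (rule mat3_eqI) (auto simp: vee_blk P_sym)
  have mass: "vee ?M $ 1 = c" by (simp add: vee_blk mat_def)
  have "hat (vee ?M) = ?M"
    unfolding hat_def skew Ibar mass ..
  then show ?thesis unfolding R by (metis rangeI)
qed

lemma Ibar_add: "Ibar (p + q) = Ibar p + Ibar q" by (simp add: Ibar_def vec_eq_iff)
lemma Ibar_scaleR: "Ibar (c *\<^sub>R p) = c *\<^sub>R Ibar p" by (simp add: Ibar_def vec_eq_iff)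
lemma hvec_add: "hvec (p + q) = hvec p + hvec q" by (simp add: hvec_def vec_eq_iff)
lemma hvec_scaleR: "hvec (c *\<^sub>R p) = c *\<^sub>R hvec p" by (simp add: hvec_def vec_eq_iff)

lemma hat_add: "hat (p + q) = hat p + hat q"
  by (simp add: hat_def blk_add Ibar_add hvec_add skew_add transpose_add scaleR_add_left)
lemma hat_scaleR: "hat (c *\<^sub>R p) = c *\<^sub>R hat p"
  by (simp add: hat_def blk_scaleR Ibar_scaleR hvec_scaleR skew_scaleR transpose_scalar)
lemma linear_hat: "linear hat"
  by (rule linearI) (simp_all add: hat_add hat_scaleR)
lemma hat_zero: "hat 0 = 0" using linear_0[OF linear_hat] .
lemma hat_uminus: "hat (- p) = - hat p" using linear_neg[OF linear_hat] .
lemma hat_diff: "hat (p - q) = hat p - hat q" using linear_diff[OF linear_hat] .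

lemma subspace_range_hat: "subspace (range hat)"
  unfolding subspace_def
  by (auto simp: hat_zero[symmetric] hat_add[symmetric] hat_scaleR[symmetric])

lemma linear_vee: "linear vee"
  by (rule linearI) (simp_all add: vee_def vec_eq_iff)

lemma transpose_Ibar: "transpose (Ibar p) = Ibar p"
  by (rule mat3_eqI) (auto simp: transpose_def)

lemma transpose_hat: "transpose (hat p) = hat p"
  by (simp add: hat_def transpose_blk transpose_Ibar transpose_scalar)

lemma inner_symmetric_matrix_commute:
  "transpose H = H \<Longrightarrow> (x::real^'n) \<bullet> (H *v y) = y \<bullet> (H *v x)"
  by (metis dot_lmul_matrix inner_commute transpose_matrix_vector)

lemma inner_hat_commute: "x \<bullet> (hat p *v y) = y \<bullet> (hat p *v x)"
  using inner_symmetric_matrix_commute[OF transpose_hat] .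

section \<open>The operators A and B\<close>

lemma Amat_congruence_in_range_hat: "transpose (scross v) ** hat y + hat y ** scross v \<in> range hat"
proof -
  define W where "W = skew (topv v)"
  define U where "U = skew (botv v)"
  define S where "S = skew (hvec y)"
  define I where "I = Ibar y"
  have T: "transpose W = - W" "transpose U = - U" "transpose S = - S" "transpose I = I"
    by (simp_all add: W_def U_def S_def I_def transpose_skew transpose_Ibar)
  have "transpose (scross v) ** hat y + hat y ** scross v =
     blk (- (W ** I) + U ** S + I ** W + S ** U) (- (W ** S) - y$1 *\<^sub>R U + S ** W)
         (W ** S + y$1 *\<^sub>R U - S ** W) (0 *\<^sub>R mat 1)"
    unfolding scross_def hat_def W_def[symmetric] U_def[symmetric] S_def[symmetric] I_def[symmetric]
    by (simp add: blk_simps T matrix_simps scaleR_mat1_mult mult_scaleR_mat1 algebra_simps)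
  also have "\<dots> \<in> range hat"
    by (rule blk_in_range_hat) (simp_all add: matrix_simps T algebra_simps)
  finally show ?thesis .
qed

lemma stransform_congruence_in_range_hat:
  assumes "is_stransform X"
  shows "transpose X ** hat y ** X \<in> range hat"
proof -
  obtain R p where R: "R \<in> SO3" and X: "X = blk R 0 (- (R ** skew p)) R"
    using assms unfolding is_stransform_def by blast
  have RR: "transpose R ** R = mat 1" using R unfolding SO3_def orthogonal_matrix_def by blast
  have RR': "A ** transpose R ** R = A" for A :: "real^3^3"
    by (metis RR matrix_mul_assoc matrix_mul_rid)
  define P where "P = skew p"
  define S where "S = skew (hvec y)"
  define I where "I = Ibar y"
  define m where "m = y$1"
  have T: "transpose P = - P" "transpose S = - S" "transpose I = I"
    by (simp_all add: P_def S_def I_def transpose_skew transpose_Ibar)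
  have "transpose X ** hat y ** X =
     blk (transpose R ** I ** R - transpose R ** S ** R ** P - P ** transpose R ** S ** R - m *\<^sub>R (P ** P))
         (transpose R ** S ** R + m *\<^sub>R P)
         (- (transpose R ** S ** R) - m *\<^sub>R P) (m *\<^sub>R mat 1)"
    unfolding X hat_def P_def[symmetric] S_def[symmetric] I_def[symmetric] m_def[symmetric]
    by (simp add: blk_simps T matrix_simps scaleR_mat1_mult mult_scaleR_mat1 matrix_mul_assoc RR RR'
        algebra_simps)
  also have "\<dots> \<in> range hat"
    by (rule blk_in_range_hat) (simp_all add: matrix_simps T matrix_mul_assoc algebra_simps)
  finally show ?thesis .
qed

lemma linear_vee_congruence: "linear (\<lambda>p. vee (M ** hat p ** K))"
  by (rule linearI) (simp_all add: hat_add hat_scaleR matrix_simps linear_add[OF linear_vee]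
      linear_scale[OF linear_vee])

lemma linear_vee_Amat_fun: "linear (\<lambda>p. vee (transpose K ** hat p + hat p ** K))"
  by (rule linearI) (simp_all add: hat_add hat_scaleR matrix_simps linear_add[OF linear_vee]
      linear_scale[OF linear_vee] algebra_simps)

lemma Amat_mult_vec: "Amat v *v y = vee (transpose (scross v) ** hat y + hat y ** scross v)"
  unfolding Amat_def using matrix_vector_mul(2)[OF linear_vee_Amat_fun] by metis

lemma Bmat_mult_vec: "Bmat M *v y = vee (M ** hat y ** transpose M)"
  unfolding Bmat_def using matrix_vector_mul(2)[OF linear_vee_congruence] by metis

lemma hat_Amat: "hat (Amat v *v y) = transpose (scross v) ** hat y + hat y ** scross v"
  unfolding Amat_mult_vec by (rule hat_vee[OF Amat_congruence_in_range_hat])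

lemma hat_Bmat_stransform:
  "is_stransform X \<Longrightarrow> hat (Bmat (transpose X) *v y) = transpose X ** hat y ** X"
  unfolding Bmat_mult_vec transpose_transpose by (rule hat_vee[OF stransform_congruence_in_range_hat])

lemma linear_functional_eq_inner:
  assumes "linear (f :: real^'n \<Rightarrow> real)"
  shows "(\<chi> k. f (axis k 1)) \<bullet> y = f y"
proof -
  have "f y = f (\<Sum>i\<in>UNIV. (y$i) *\<^sub>R axis i 1)"
    using basis_expansion[of y] by (simp add: scalar_mult_eq_scaleR)
  also have "\<dots> = (\<Sum>i\<in>UNIV. y$i * f (axis i 1))"
    by (simp add: linear_sum[OF assms] linear_scale[OF assms])
  finally show ?thesis by (simp add: inner_vec_def mult.commute)
qed

lemma linear_inner_hat: "linear (\<lambda>y. c \<bullet> (hat y *v v))"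
  by (rule linearI) (simp_all add: hat_add hat_scaleR matrix_vector_mult_add_rdistrib
      matrix_vector_mult_scaleR_left inner_add_right)

lemma Cmat_orthogonal_iff:
  "(\<forall>r\<in>set (Cmat V v). r \<bullet> y = 0) \<longleftrightarrow> (\<forall>c\<in>set V. c \<bullet> (hat y *v v) = 0)"
  by (auto simp: Cmat_def linear_functional_eq_inner[OF linear_inner_hat])


section \<open>Linear ODEs\<close>

lemma linear_ode_zero_unique_nonneg:
  fixes u :: "real \<Rightarrow> 'a::euclidean_space"
  assumes L: "linear L" and d: "\<And>s. (u has_vector_derivative L (u s)) (at s)" and u0: "u 0 = 0"
    and s: "0 \<le> s"
  shows "u s = 0"
proof -
  obtain C where C: "C > 0" "\<And>x. norm (L x) \<le> norm x * C"
    using bounded_linear.pos_bounded[OF linear_conv_bounded_linear[THEN iffD1, OF L]] by blast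
  define f where "f t = exp (- (2*C) * t) * (u t \<bullet> u t)" for t
  have df: "(f has_real_derivative (exp (- (2*C) * t) * (- (2*C)) * (u t \<bullet> u t)
              + exp (- (2*C) * t) * (2 * (u t \<bullet> L (u t))))) (at t)" for t
  proof -
    have i: "((\<lambda>t. u t \<bullet> u t) has_real_derivative (u t \<bullet> L (u t) + L (u t) \<bullet> u t)) (at t)"
      unfolding has_real_derivative_iff_has_vector_derivative
      using bounded_bilinear.has_vector_derivative[OF bounded_bilinear_inner d d] by simp
    have e: "((\<lambda>t. exp (- (2*C) * t)) has_real_derivative exp (- (2*C) * t) * (- (2*C))) (at t)"
      by (auto intro!: derivative_eq_intros)
    show ?thesis unfolding f_def using DERIV_mult[OF e i] by (simp add: inner_commute algebra_simps)
  qed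
  \<comment> \<open>Gronwall: \<open>|u|\<^sup>2 e\<^sup>-\<^sup>2\<^sup>C\<^sup>t\<close> is nonincreasing and starts at \<open>0\<close>.\<close>
  have nonpos: "exp (- (2*C) * t) * (- (2*C)) * (u t \<bullet> u t) + exp (- (2*C) * t) * (2 * (u t \<bullet> L (u t))) \<le> 0"
    for t
  proof -
    have "u t \<bullet> L (u t) \<le> norm (u t) * norm (L (u t))" by (rule norm_cauchy_schwarz)
    also have "\<dots> \<le> norm (u t) * (norm (u t) * C)" by (simp add: C(2) mult_left_mono)
    finally have "u t \<bullet> L (u t) \<le> C * (u t \<bullet> u t)"
      by (simp add: dot_square_norm power2_eq_square algebra_simps)
    then have "exp (- (2*C) * t) * ((- (2*C)) * (u t \<bullet> u t) + 2 * (u t \<bullet> L (u t))) \<le> 0"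
      by (simp add: mult_nonneg_nonpos)
    then show ?thesis by (simp add: algebra_simps)
  qed
  have "f s \<le> f 0"
    by (rule DERIV_nonpos_imp_nonincreasing[OF s]) (use df nonpos in blast)
  then have "u s \<bullet> u s \<le> 0" by (simp add: f_def u0 mult_le_0_iff)
  then show ?thesis by (metis inner_ge_zero inner_eq_zero_iff order_antisym)
qed

lemma linear_ode_zero_unique:
  fixes u :: "real \<Rightarrow> 'a::euclidean_space"
  assumes L: "linear L" and d: "\<And>s. (u has_vector_derivative L (u s)) (at s)" and u0: "u 0 = 0"
  shows "u s = 0"
proof (cases "0 \<le> s")
  case True then show ?thesis using linear_ode_zero_unique_nonneg[OF L d u0] by blast
next
  case False
  define w where "w t = u (- t)" for t
  have L': "linear (\<lambda>x. - L x)" using L by (simp add: linear_compose_neg)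
  have dw: "(w has_vector_derivative - L (w t)) (at t)" for t
  proof -
    have "((u \<circ> uminus) has_vector_derivative ((-1) *\<^sub>R L (u (- t)))) (at t)"
      by (rule vector_diff_chain_at) (auto intro!: derivative_eq_intros d)
    then show ?thesis unfolding w_def[abs_def] by (simp add: o_def)
  qed
  have "w (- s) = 0" using linear_ode_zero_unique_nonneg[OF L' dw, of "- s"] u0 False by (simp add: w_def)
  then show ?thesis by (simp add: w_def)
qed

lemma subspace_kernel_projection:
  fixes S :: "'a::euclidean_space set"
  assumes S: "subspace S"
  obtains P where "linear P" "\<And>x. P x = 0 \<longleftrightarrow> x \<in> S" "\<And>x. x - P x \<in> S"
proof -
  obtain B where B: "B \<subseteq> S" "pairwise orthogonal B" "span B = S"
    using orthogonal_basis_subspace[OF S] by blast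
  define pr where "pr x = (\<Sum>b\<in>B. (b \<bullet> x / (b \<bullet> b)) *\<^sub>R b)" for x
  define P where "P x = x - pr x" for x
  have prS: "pr x \<in> S" for x
  proof -
    have "pr x \<in> span B" unfolding pr_def by (intro span_sum span_mul span_base)
    then show ?thesis using B(3) by simp
  qed
  have lin: "linear P"
  proof -
    have a: "pr (x + y) = pr x + pr y" for x y
      unfolding pr_def by (simp add: inner_add_right add_divide_distrib scaleR_add_left sum.distrib)
    have b: "pr (c *\<^sub>R x) = c *\<^sub>R pr x" for c x
      unfolding pr_def by (simp add: scaleR_sum_right)
    show ?thesis unfolding P_def by (rule linearI) (simp_all add: a b scaleR_diff_right)
  qed
  have orth: "orthogonal y (P x)" if "y \<in> S" for x y
    unfolding P_def pr_def using Gram_Schmidt_step[OF B(2)] that B(3) by blast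
  have "P x = 0 \<longleftrightarrow> x \<in> S" for x
  proof
    assume "P x = 0" then have "x = pr x" by (simp add: P_def)
    then show "x \<in> S" using prS by metis
  next
    assume "x \<in> S"
    then have "P x \<in> S" unfolding P_def using prS S by (simp add: subspace_diff)
    then have "orthogonal (P x) (P x)" using orth by blast
    then show "P x = 0" by (simp add: orthogonal_def)
  qed
  moreover have "x - P x \<in> S" for x using prS by (simp add: P_def)
  ultimately show ?thesis using that lin by blast
qed

lemma linear_ode_invariant_subspace:
  fixes w :: "real \<Rightarrow> 'a::euclidean_space"
  assumes S: "subspace S" and L: "linear L" and LS: "\<And>x. x \<in> S \<Longrightarrow> L x \<in> S"
    and d: "\<And>s. (w has_vector_derivative L (w s)) (at s)" and w0: "w 0 \<in> S"
  shows "w s \<in> S"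
proof -
  obtain P where P: "linear P" "\<And>x. P x = 0 \<longleftrightarrow> x \<in> S" "\<And>x. x - P x \<in> S"
    using subspace_kernel_projection[OF S] by blast
  have bP: "bounded_linear P" using P(1) linear_conv_bounded_linear by blast
  have PL: "P (L x) = P (L (P x))" for x
  proof -
    have "L (x - P x) \<in> S" using LS P(3) by blast
    then have "P (L (x - P x)) = 0" using P(2) by blast
    then show ?thesis using linear_diff[OF P(1)] linear_diff[OF L] by (metis eq_iff_diff_eq_0)
  qed
  \<comment> \<open>the component of \<open>w\<close> transversal to \<open>S\<close> solves a linear ODE of its own\<close>
  have du: "((\<lambda>t. P (w t)) has_vector_derivative (P \<circ> L) (P (w s))) (at s)" for s
    using bounded_linear.has_vector_derivative[OF bP d[of s]] PL by (simp add: o_def)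
  have "P (w s) = 0"
    by (rule linear_ode_zero_unique[of "P \<circ> L" "\<lambda>t. P (w t)", OF linear_compose[OF L P(1)] du])
       (use P(2) w0 in blast)
  then show ?thesis using P(2) by blast
qed

lemma linear_funpow: "linear (L::'a::real_vector \<Rightarrow> 'a) \<Longrightarrow> linear (L ^^ k)"
proof (induction k)
  case 0 show ?case by (rule linearI) simp_all
next
  case (Suc k) then show ?case using linear_compose[OF Suc.IH Suc.prems] by (simp add: o_def)
qed

lemma span_krylov_invariant:
  assumes L: "linear L" and last: "(L ^^ m) z \<in> span ((\<lambda>k. (L ^^ k) z) ` {..<m})"
    and x: "x \<in> span ((\<lambda>k. (L ^^ k) z) ` {..<m})"
  shows "L x \<in> span ((\<lambda>k. (L ^^ k) z) ` {..<m})"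
proof -
  let ?V = "span ((\<lambda>k. (L ^^ k) z) ` {..<m})"
  have "L ` ((\<lambda>k. (L ^^ k) z) ` {..<m}) \<subseteq> ?V"
  proof
    fix y assume "y \<in> L ` ((\<lambda>k. (L ^^ k) z) ` {..<m})"
    then obtain k where k: "k < m" "y = (L ^^ Suc k) z" by auto
    show "y \<in> ?V"
    proof (cases "Suc k < m")
      case True
      then show ?thesis using k by (auto intro: span_base simp del: funpow.simps)
    next
      case False then show ?thesis using k last by (metis Suc_lessI)
    qed
  qed
  then have "span (L ` ((\<lambda>k. (L ^^ k) z) ` {..<m})) \<subseteq> ?V"
    by (simp add: span_minimal)
  then show ?thesis using x linear_span_image[OF L] by auto
qed

lemma krylov_sequence_dependent:
  fixes L :: "'a::euclidean_space \<Rightarrow> 'a"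
  shows "\<exists>m \<le> DIM('a). (L ^^ m) z \<in> span ((\<lambda>k. (L ^^ k) z) ` {..<m})"
proof (rule ccontr)
  assume "\<not> ?thesis"
  then have nin: "\<And>m. m \<le> DIM('a) \<Longrightarrow> (L ^^ m) z \<notin> span ((\<lambda>k. (L ^^ k) z) ` {..<m})" by blast
  have "m \<le> Suc DIM('a) \<Longrightarrow> dim ((\<lambda>k. (L ^^ k) z) ` {..<m}) = m" for m
  proof (induction m)
    case 0 then show ?case by simp
  next
    case (Suc m)
    then show ?case using nin[of m] by (simp add: lessThan_Suc dim_insert)
  qed
  then have "dim ((\<lambda>k. (L ^^ k) z) ` {..<Suc DIM('a)}) = Suc DIM('a)" by simp
  then show False using dim_subset_UNIV[of "(\<lambda>k. (L ^^ k) z) ` {..<Suc DIM('a)}"] by simp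
qed

lemma funpow_in_span_krylov:
  fixes L :: "'a::euclidean_space \<Rightarrow> 'a"
  assumes L: "linear L"
  shows "(L ^^ n) z \<in> span ((\<lambda>k. (L ^^ k) z) ` {..<DIM('a)})"
proof -
  define V where "V m = span ((\<lambda>k. (L ^^ k) z) ` {..<m})" for m
  obtain m where m: "m \<le> DIM('a)" "(L ^^ m) z \<in> V m"
    using krylov_sequence_dependent unfolding V_def by blast
  have "(L ^^ n) z \<in> V m"
  proof (induction n)
    case 0 show ?case
    proof (cases "m = 0")
      case True then show ?thesis using m by simp
    next
      case False
      then have "(L ^^ 0) z \<in> (\<lambda>k. (L ^^ k) z) ` {..<m}" by (intro image_eqI[of _ _ 0]) auto
      then show ?thesis by (auto simp: V_def intro: span_base simp del: funpow.simps)
    qed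
  next
    case (Suc n)
    then show ?case using span_krylov_invariant[OF L] m(2) unfolding V_def by simp
  qed
  moreover have "V m \<subseteq> V DIM('a)" unfolding V_def using m(1) by (intro span_mono image_mono) auto
  ultimately show ?thesis unfolding V_def by blast
qed

lemma linear_ode_functional_vanishes_iff:
  fixes w :: "real \<Rightarrow> 'a::euclidean_space" and P :: "'a \<Rightarrow> real"
  assumes L: "linear L" and d: "\<And>s. (w has_vector_derivative L (w s)) (at s)" and P: "linear P"
  shows "(\<forall>s. P (w s) = 0) \<longleftrightarrow> (\<forall>k<DIM('a). P ((L ^^ k) (w 0)) = 0)"
proof
  assume h: "\<forall>s. P (w s) = 0"
  have "\<forall>s. P ((L ^^ k) (w s)) = 0" for k
  proof (induction k)
    case 0 then show ?case using h by simp
  next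
    case (Suc k)
    show ?case
    proof
      fix s
      have bl: "bounded_linear (P \<circ> (L ^^ k))"
        using linear_compose[OF linear_funpow[OF L] P] linear_conv_bounded_linear by blast
      have "((\<lambda>t. (P \<circ> (L ^^ k)) (w t)) has_vector_derivative (P \<circ> (L ^^ k)) (L (w s))) (at s)"
        by (rule bounded_linear.has_vector_derivative[OF bl d])
      then have D1: "((\<lambda>t. P ((L ^^ k) (w t))) has_real_derivative P ((L ^^ Suc k) (w s))) (at s)"
        by (simp add: has_real_derivative_iff_has_vector_derivative funpow_swap1 o_def)
      have D2: "((\<lambda>t. P ((L ^^ k) (w t))) has_real_derivative 0) (at s)"
        using Suc.IH by simp
      show "P ((L ^^ Suc k) (w s)) = 0" using DERIV_unique[OF D1 D2] .
    qed
  qed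
  then show "\<forall>k<DIM('a). P ((L ^^ k) (w 0)) = 0" by blast
next
  assume h: "\<forall>k<DIM('a). P ((L ^^ k) (w 0)) = 0"
  define S where "S = span ((\<lambda>k. (L ^^ k) (w 0)) ` {..<DIM('a)})"
  have LS: "L x \<in> S" if "x \<in> S" for x
    using span_krylov_invariant[OF L funpow_in_span_krylov[OF L]] that by (simp add: S_def)
  have w0: "w 0 \<in> S" using funpow_in_span_krylov[OF L, of 0 "w 0"] by (simp add: S_def)
  have "S \<subseteq> {x. P x = 0}" unfolding S_def
    by (rule span_minimal) (use h in \<open>auto intro: linear_subspace_kernel[OF P]\<close>)
  then show "\<forall>s. P (w s) = 0"
    using linear_ode_invariant_subspace[OF _ L LS d w0] by (auto simp: S_def)
qed

lemma funpow_uminus: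
  assumes "linear (f::'a::real_vector \<Rightarrow> 'a)"
  shows "((\<lambda>x. - f x) ^^ k) z = ((-1::real) ^ k) *\<^sub>R (f ^^ k) z"
proof (induction k)
  case 0 then show ?case by simp
next
  case (Suc k)
  then show ?case by (simp add: linear_neg[OF assms] linear_scale[OF assms])
qed

lemma linear_ode_neg_matrix_functional_vanishes_iff:
  fixes w :: "real \<Rightarrow> real^'n"
  assumes d: "\<And>s. (w has_vector_derivative - (A *v w s)) (at s)"
  shows "(\<forall>s. l \<bullet> w s = 0) \<longleftrightarrow> (\<forall>k<CARD('n). l \<bullet> ((((*v) A) ^^ k) (w 0)) = 0)"
proof -
  have lin: "linear (\<lambda>x. - (A *v x))" using linear_compose_neg[OF matrix_vector_mul_linear] .
  have lin_l: "linear (\<lambda>x. l \<bullet> x)" by (rule linearI) (simp_all add: inner_add_right)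
  have "(\<forall>s. l \<bullet> w s = 0) \<longleftrightarrow> (\<forall>k<DIM(real^'n). l \<bullet> (((\<lambda>x. - (A *v x)) ^^ k) (w 0)) = 0)"
    by (rule linear_ode_functional_vanishes_iff[OF lin d lin_l])
  then show ?thesis by (simp add: funpow_uminus[OF matrix_vector_mul_linear])
qed


section \<open>A single joint\<close>

lemma linear_matrix_mult_left: "linear (\<lambda>M. (K::real^'n^'m) ** (M::real^'p^'n))"
  by (rule linearI) (simp_all add: matrix_add_ldistrib matrix_scaleR_right)
lemma linear_matrix_mult_right: "linear (\<lambda>M. (M::real^'n^'m) ** (K::real^'p^'n))"
  by (rule linearI) (simp_all add: matrix_add_rdistrib matrix_scaleR_left)
lemma linear_matrix_vector_mult_left: "linear (\<lambda>M. (M::real^'n^'m) *v (z::real^'n))"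
  by (rule linearI) (simp_all add: matrix_vector_mult_add_rdistrib matrix_vector_mult_scaleR_left)
lemma linear_transpose: "linear (transpose :: real^'n^'m \<Rightarrow> real^'m^'n)"
  by (rule linearI) (simp_all add: transpose_add transpose_scalar)

lemma bounded_linear_matrix_mult_left: "bounded_linear (\<lambda>M. (K::real^'n^'m) ** (M::real^'p^'n))"
  using linear_matrix_mult_left linear_conv_bounded_linear by blast
lemma bounded_linear_matrix_mult_right: "bounded_linear (\<lambda>M. (M::real^'n^'m) ** (K::real^'p^'n))"
  using linear_matrix_mult_right linear_conv_bounded_linear by blast
lemma bounded_linear_matrix_vector_mult_left: "bounded_linear (\<lambda>M. (M::real^'n^'m) *v (z::real^'n))"
  using linear_matrix_vector_mult_left linear_conv_bounded_linear by blast
lemma bounded_linear_transpose: "bounded_linear (transpose :: real^'n^'m \<Rightarrow> real^'m^'n)"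
  using linear_transpose linear_conv_bounded_linear by blast
lemma bounded_linear_vee: "bounded_linear vee"
  using linear_vee linear_conv_bounded_linear by blast

lemma bounded_bilinear_matrix_mult: "bounded_bilinear (\<lambda>(A::real^'n^'m) (B::real^'p^'n). A ** B)"
proof -
  have "bilinear (\<lambda>(A::real^'n^'m) (B::real^'p^'n). A ** B)"
    unfolding bilinear_def using linear_matrix_mult_left linear_matrix_mult_right by blast
  then show ?thesis using bilinear_conv_bounded_bilinear by blast
qed

locale joint =
  fixes Phi :: "real^6" and X :: "real \<Rightarrow> real^6^6"
  assumes X_0: "X 0 = mat 1"
    and X_deriv: "\<And>q. (X has_vector_derivative - (scross Phi ** X q)) (at q)"
begin

lemma scross_commute: "scross Phi ** X s = X s ** scross Phi"
proof -
  let ?K = "scross Phi"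
  define u where "u s = ?K ** X s - X s ** ?K" for s
  have d: "(u has_vector_derivative (\<lambda>Z. - (?K ** Z)) (u s)) (at s)" for s
  proof -
    have a: "((\<lambda>t. ?K ** X t) has_vector_derivative ?K ** (- (?K ** X s))) (at s)"
      using bounded_linear.has_vector_derivative[OF bounded_linear_matrix_mult_left X_deriv] .
    have b: "((\<lambda>t. X t ** ?K) has_vector_derivative (- (?K ** X s)) ** ?K) (at s)"
      using bounded_linear.has_vector_derivative[OF bounded_linear_matrix_mult_right X_deriv] .
    show ?thesis unfolding u_def[abs_def] using has_vector_derivative_diff[OF a b]
      by (simp add: matrix_simps matrix_mul_assoc)
  qed
  have "u s = 0"
    by (rule linear_ode_zero_unique[OF linear_compose_neg[OF linear_matrix_mult_left] d])
       (simp add: u_def X_0)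
  then show ?thesis by (simp add: u_def)
qed

lemma congruence_has_vector_derivative:
  "((\<lambda>t. transpose (X t) ** H ** X t) has_vector_derivative
     - (transpose (scross Phi) ** (transpose (X s) ** H ** X s) + (transpose (X s) ** H ** X s) ** scross Phi))
   (at s)"
proof -
  have XT: "((\<lambda>t. transpose (X t)) has_vector_derivative transpose (- (scross Phi ** X s))) (at s)"
    using bounded_linear.has_vector_derivative[OF bounded_linear_transpose X_deriv] .
  have XTH: "((\<lambda>t. transpose (X t) ** H) has_vector_derivative transpose (- (scross Phi ** X s)) ** H) (at s)"
    using bounded_linear.has_vector_derivative[OF bounded_linear_matrix_mult_right XT] .
  have "((\<lambda>t. (transpose (X t) ** H) ** X t) has_vector_derivative
      (transpose (X s) ** H) ** (- (scross Phi ** X s)) + (transpose (- (scross Phi ** X s)) ** H) ** X s) (at s)"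
    using bounded_bilinear.has_vector_derivative[OF bounded_bilinear_matrix_mult XTH X_deriv] .
  then show ?thesis
    by (simp add: matrix_simps matrix_mul_assoc scross_commute algebra_simps)
qed

text \<open>\<open>X(s)\<close> is not assumed to be a spatial transform, so \<open>hat_Bmat_stransform\<close> does not apply;
  instead the congruence stays in the range of \<open>hat\<close> because its ODE preserves that subspace.\<close>

lemma hat_Bmat_joint: "hat (Bmat (transpose (X s)) *v y) = transpose (X s) ** hat y ** X s"
proof -
  have "transpose (X s) ** hat y ** X s \<in> range hat"
  proof (rule linear_ode_invariant_subspace[OF subspace_range_hat])
    show "linear (\<lambda>M. - (transpose (scross Phi) ** M + M ** scross Phi))"
      by (intro linear_compose_neg linear_compose_add linear_matrix_mult_left linear_matrix_mult_right)
    show "- (transpose (scross Phi) ** M + M ** scross Phi) \<in> range hat" if "M \<in> range hat" for M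
      using that hat_Amat[of Phi] hat_uminus by (metis imageE rangeI)
    show "transpose (X 0) ** hat y ** X 0 \<in> range hat" by (simp add: X_0)
  qed (rule congruence_has_vector_derivative)
  then show ?thesis unfolding Bmat_mult_vec transpose_transpose by (rule hat_vee)
qed

lemma Bmat_joint_0: "Bmat (transpose (X 0)) *v y = y"
  by (simp add: Bmat_mult_vec X_0)

lemma Bmat_joint_Amat: "Bmat (transpose (X s)) *v (Amat Phi *v y) = Amat Phi *v (Bmat (transpose (X s)) *v y)"
proof -
  have "transpose (scross Phi) ** transpose (X s) = transpose (X s) ** transpose (scross Phi)"
    by (metis scross_commute matrix_transpose_mul)
  then have "hat (Bmat (transpose (X s)) *v (Amat Phi *v y)) = hat (Amat Phi *v (Bmat (transpose (X s)) *v y))"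
    unfolding hat_Bmat_joint hat_Amat
    by (simp add: matrix_simps matrix_mul_assoc) (metis scross_commute matrix_mul_assoc)
  then show ?thesis by (simp add: hat_inj)
qed

lemma Bmat_joint_has_vector_derivative:
  "((\<lambda>t. Bmat (transpose (X t)) *v y) has_vector_derivative - (Amat Phi *v (Bmat (transpose (X s)) *v y))) (at s)"
proof -
  have "((\<lambda>t. vee (transpose (X t) ** hat y ** X t)) has_vector_derivative
        vee (- (transpose (scross Phi) ** (transpose (X s) ** hat y ** X s)
                + (transpose (X s) ** hat y ** X s) ** scross Phi))) (at s)"
    using bounded_linear.has_vector_derivative[OF bounded_linear_vee congruence_has_vector_derivative] .
  moreover have "vee (- (transpose (scross Phi) ** (transpose (X s) ** hat y ** X s)
                + (transpose (X s) ** hat y ** X s) ** scross Phi))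
      = - (Amat Phi *v (Bmat (transpose (X s)) *v y))"
    by (metis hat_Amat hat_Bmat_joint hat_uminus vee_hat)
  ultimately show ?thesis by (simp add: Bmat_mult_vec)
qed

lemma joint_vector_orthogonal_iff:
  "(\<forall>s. l \<bullet> (X s *v z) = 0) \<longleftrightarrow> (\<forall>k<6. l \<bullet> ((((*v) (scross Phi)) ^^ k) z) = 0)"
proof -
  have "((\<lambda>t. X t *v z) has_vector_derivative - (scross Phi *v (X s *v z))) (at s)" for s
    using bounded_linear.has_vector_derivative[OF bounded_linear_matrix_vector_mult_left X_deriv]
    by (simp add: matrix_vector_mult_uminus matrix_vector_mul_assoc)
  from linear_ode_neg_matrix_functional_vanishes_iff[OF this] show ?thesis by (simp add: X_0)
qed

lemma Bmat_joint_orthogonal_iff: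
  "(\<forall>s. l \<bullet> (Bmat (transpose (X s)) *v y) = 0) \<longleftrightarrow> (\<forall>k<10. l \<bullet> ((((*v) (Amat Phi)) ^^ k) y) = 0)"
  using linear_ode_neg_matrix_functional_vanishes_iff[OF Bmat_joint_has_vector_derivative]
  by (simp add: Bmat_joint_0)

lemma Bmat_joint_diff_orthogonal_iff:
  "(\<forall>s. l \<bullet> (Bmat (transpose (X s)) *v y - y) = 0)
   \<longleftrightarrow> (\<forall>k<10. l \<bullet> ((((*v) (Amat Phi)) ^^ k) (Amat Phi *v y)) = 0)"
proof -
  let ?f = "\<lambda>t. l \<bullet> (Bmat (transpose (X t)) *v y)"
  have df: "(?f has_real_derivative - (l \<bullet> (Bmat (transpose (X s)) *v (Amat Phi *v y)))) (at s)" for s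
  proof -
    have "(?f has_vector_derivative l \<bullet> (- (Amat Phi *v (Bmat (transpose (X s)) *v y)))) (at s)"
      using bounded_linear.has_vector_derivative[OF bounded_linear_inner_right Bmat_joint_has_vector_derivative] .
    then show ?thesis by (simp add: has_real_derivative_iff_has_vector_derivative Bmat_joint_Amat)
  qed
  have "(\<forall>s. l \<bullet> (Bmat (transpose (X s)) *v y - y) = 0) \<longleftrightarrow> (\<forall>s. l \<bullet> (Bmat (transpose (X s)) *v (Amat Phi *v y)) = 0)"
  proof
    assume h: "\<forall>s. l \<bullet> (Bmat (transpose (X s)) *v y - y) = 0"
    show "\<forall>s. l \<bullet> (Bmat (transpose (X s)) *v (Amat Phi *v y)) = 0"
    proof
      fix s
      have "(?f has_real_derivative 0) (at s)"
        using h by (simp add: inner_diff_right)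
      then show "l \<bullet> (Bmat (transpose (X s)) *v (Amat Phi *v y)) = 0" using DERIV_unique[OF df] by force
    qed
  next
    assume "\<forall>s. l \<bullet> (Bmat (transpose (X s)) *v (Amat Phi *v y)) = 0"
    then have "\<forall>s. (?f has_real_derivative 0) (at s)" using df by simp
    then have "?f s = ?f 0" for s by (rule DERIV_isconst_all)
    then show "\<forall>s. l \<bullet> (Bmat (transpose (X s)) *v y - y) = 0" by (simp add: Bmat_joint_0 inner_diff_right)
  qed
  also have "\<dots> \<longleftrightarrow> (\<forall>k<10. l \<bullet> ((((*v) (Amat Phi)) ^^ k) (Amat Phi *v y)) = 0)"
    by (rule Bmat_joint_orthogonal_iff)
  finally show ?thesis .
qed

end


section \<open>The chain\<close>

lemma vel_fun_upd_below:
  "j < m \<Longrightarrow> vel XJ XJ0 Phi (q(m := a)) (qd(m := b)) j = vel XJ XJ0 Phi q qd j"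
  by (induction j) auto

lemma Xto0_fun_upd_below: "j < m \<Longrightarrow> Xto0 XJ XJ0 (q(m := a)) j = Xto0 XJ XJ0 q j"
  by (induction j) auto

lemma all_fun_upd_iff: "(\<forall>q qd. P q qd) \<longleftrightarrow> (\<forall>q qd s u. P (q(m := s)) (qd(m := u)))"
  by (metis fun_upd_triv)

lemma quadratic_eq_0_iff: "(\<forall>u::real. a + u * b + u * u * c = 0) \<longleftrightarrow> a = 0 \<and> b = 0 \<and> c = 0"
proof
  assume h: "\<forall>u::real. a + u * b + u * u * c = 0"
  have "a = 0" "a + b + c = 0" "a - b + c = 0"
    using h[rule_format, of 0] h[rule_format, of 1] h[rule_format, of "-1"] by simp_all
  then show "a = 0 \<and> b = 0 \<and> c = 0" by linarith
qed simp

lemma affine_eq_0_iff: "(\<forall>u::real. a + u * b = 0) \<longleftrightarrow> a = 0 \<and> b = 0"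
  using quadratic_eq_0_iff[of a b 0] by simp

lemma inner_matrix_vector_mult: "(l::real^'n) \<bullet> (M *v x) = (l v* M) \<bullet> x"
  by (simp add: dot_lmul_matrix)

lemma inner_congruence: "(M *v a) \<bullet> (H *v (M *v b)) = (a::real^'n) \<bullet> ((transpose M ** H ** M) *v b)"
  by (simp add: inner_matrix_vector_mult matrix_vector_mul_assoc[symmetric] dot_lmul_matrix
      transpose_matrix_vector[symmetric] del: transpose_matrix_vector)

lemma vector_matrix_funpow_inner:
  "(((\<lambda>x. x v* (A::real^'n^'n)) ^^ k) r) \<bullet> y = r \<bullet> ((((*v) A) ^^ k) y)"
proof (induction k arbitrary: y)
  case 0 then show ?case by simp
next
  case (Suc k)
  then show ?case by (simp add: dot_lmul_matrix funpow_swap1)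
qed

lemma set_Vt_Suc: "c \<in> set (Vt XJ0 Phi ag (Suc j)) \<longleftrightarrow>
   c = Phi (Suc j) \<or> (\<exists>k<6. \<exists>c'\<in>set (Vt XJ0 Phi ag j).
     c = (((*v) (scross (Phi (Suc j)))) ^^ k) (XJ0 (Suc j) *v c'))"
  by (auto simp: Let_def)

lemma Omat_orthogonal_iff: "(\<forall>r'\<in>set (Omat XJ0 Phi C i). r' \<bullet> y = 0) \<longleftrightarrow>
   (\<forall>r\<in>set C. \<forall>k<10. (r v* Bmat (transpose (XJ0 i))) \<bullet> ((((*v) (Amat (Phi i))) ^^ k) y) = 0)"
  by (auto simp: Omat_def Dmat_def vector_matrix_funpow_inner)

locale chain =
  fixes N :: nat and XJ :: "nat \<Rightarrow> real \<Rightarrow> real^6^6" and XJ0 :: "nat \<Rightarrow> real^6^6"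
    and Phi :: "nat \<Rightarrow> real^6" and ag :: "real^6"
  assumes stransform: "\<forall>i\<in>{1..N}. is_stransform (XJ0 i)"
    and joint_0: "\<forall>i\<in>{1..N}. XJ i 0 = mat 1"
    and joint_deriv: "\<forall>i\<in>{1..N}. \<forall>q. (XJ i has_vector_derivative (- (scross (Phi i) ** XJ i q))) (at q)"
begin

lemma joint_at: "i \<in> {1..N} \<Longrightarrow> joint (Phi i) (XJ i)"
  using joint_0 joint_deriv by unfold_locales auto

abbreviation "v q qd j \<equiv> vel XJ XJ0 Phi q qd j"
abbreviation "g q j \<equiv> Xto0 XJ XJ0 q j *v ag"
abbreviation "BJ i \<equiv> Bmat (transpose (XJ0 i))"
abbreviation "BX i s \<equiv> Bmat (transpose (XJ i s))"

lemma v_Suc_fun_upd: "v (q(Suc j := s)) (qd(Suc j := u)) (Suc j) =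
   XJ (Suc j) s *v (XJ0 (Suc j) *v v q qd j) + u *\<^sub>R Phi (Suc j)"
  by (simp add: vel_fun_upd_below matrix_vector_mul_assoc)

lemma g_Suc_fun_upd: "g (q(Suc j := s)) (Suc j) = XJ (Suc j) s *v (XJ0 (Suc j) *v g q j)"
  by (simp add: Xto0_fun_upd_below matrix_vector_mul_assoc matrix_mul_assoc)

definition motion_orthogonal :: "nat \<Rightarrow> real^6 \<Rightarrow> bool" where
  "motion_orthogonal j l \<longleftrightarrow> (\<forall>q qd. l \<bullet> v q qd j = 0 \<and> l \<bullet> g q j = 0)"

lemma motion_orthogonal_Suc_iff:
  "motion_orthogonal (Suc j) l \<longleftrightarrow> l \<bullet> Phi (Suc j) = 0 \<and>
   (\<forall>s. motion_orthogonal j ((l v* XJ (Suc j) s) v* XJ0 (Suc j)))"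
proof -
  have "motion_orthogonal (Suc j) l \<longleftrightarrow> (\<forall>q qd s u.
       l \<bullet> (XJ (Suc j) s *v (XJ0 (Suc j) *v v q qd j)) + u * (l \<bullet> Phi (Suc j)) = 0
     \<and> l \<bullet> (XJ (Suc j) s *v (XJ0 (Suc j) *v g q j)) = 0)"
    unfolding motion_orthogonal_def
    by (subst all_fun_upd_iff[where m="Suc j"])
       (simp only: v_Suc_fun_upd g_Suc_fun_upd inner_add_right inner_scaleR_right)
  also have "\<dots> \<longleftrightarrow> (\<forall>q qd s.
       (\<forall>u. l \<bullet> (XJ (Suc j) s *v (XJ0 (Suc j) *v v q qd j)) + u * (l \<bullet> Phi (Suc j)) = 0)
     \<and> l \<bullet> (XJ (Suc j) s *v (XJ0 (Suc j) *v g q j)) = 0)"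
    by blast
  finally show ?thesis
    unfolding affine_eq_0_iff motion_orthogonal_def by (auto simp: inner_matrix_vector_mult)
qed

lemma Ball_set_Vt_Suc: "(\<forall>c\<in>set (Vt XJ0 Phi ag (Suc j)). P c) \<longleftrightarrow> P (Phi (Suc j)) \<and>
   (\<forall>c\<in>set (Vt XJ0 Phi ag j). \<forall>k<6. P ((((*v) (scross (Phi (Suc j)))) ^^ k) (XJ0 (Suc j) *v c)))"
  unfolding Ball_def set_Vt_Suc by blast

lemma motion_orthogonal_iff_Vt:
  "j \<le> N \<Longrightarrow> motion_orthogonal j l \<longleftrightarrow> (\<forall>c\<in>set (Vt XJ0 Phi ag j). l \<bullet> c = 0)"
proof (induction j arbitrary: l)
  case 0 then show ?case by (simp add: motion_orthogonal_def)
next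
  case (Suc j)
  interpret J: joint "Phi (Suc j)" "XJ (Suc j)" using joint_at Suc.prems by simp
  have "(\<forall>s. motion_orthogonal j ((l v* XJ (Suc j) s) v* XJ0 (Suc j)))
     \<longleftrightarrow> (\<forall>c\<in>set (Vt XJ0 Phi ag j). \<forall>s. l \<bullet> (XJ (Suc j) s *v (XJ0 (Suc j) *v c)) = 0)"
    using Suc by (auto simp: inner_matrix_vector_mult)
  also have "\<dots> \<longleftrightarrow> (\<forall>c\<in>set (Vt XJ0 Phi ag j). \<forall>k<6.
      l \<bullet> ((((*v) (scross (Phi (Suc j)))) ^^ k) (XJ0 (Suc j) *v c)) = 0)"
    using J.joint_vector_orthogonal_iff by blast
  finally show ?case
    unfolding motion_orthogonal_Suc_iff Ball_set_Vt_Suc by blast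
qed

definition param_invisible :: "nat \<Rightarrow> real^10 \<Rightarrow> bool" where
  "param_invisible j y \<longleftrightarrow>
     (\<forall>q qd. v q qd j \<bullet> (hat y *v v q qd j) = 0 \<and> v q qd j \<bullet> (hat y *v g q j) = 0)"

lemma inner_hat_joint:
  assumes "Suc j \<le> N"
  shows "(XJ (Suc j) s *v (XJ0 (Suc j) *v a)) \<bullet> (hat y *v (XJ (Suc j) s *v (XJ0 (Suc j) *v b)))
         = a \<bullet> (hat (BJ (Suc j) *v (BX (Suc j) s *v y)) *v b)"
proof -
  interpret J: joint "Phi (Suc j)" "XJ (Suc j)" using joint_at assms by simp
  have S: "is_stransform (XJ0 (Suc j))" using stransform assms by simp
  show ?thesis
    unfolding inner_congruence J.hat_Bmat_joint[symmetric] hat_Bmat_stransform[OF S] ..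
qed

lemma inner_hat_diff:
  "a \<bullet> (hat (B *v y) *v b) - a \<bullet> (hat (B *v z) *v b) = a \<bullet> (hat (B *v (y - z)) *v b)"
  by (simp add: matrix_vector_mult_diff_distrib hat_diff matrix_vector_mult_diff_rdistrib inner_diff_right)

lemma kinetic_step_expansion:
  assumes "Suc j \<le> N"
  shows "v (q(Suc j := s)) (qd(Suc j := u)) (Suc j) \<bullet> (hat y *v v (q(Suc j := s)) (qd(Suc j := u)) (Suc j))
        - v q qd j \<bullet> (hat (BJ (Suc j) *v z) *v v q qd j)
      = v q qd j \<bullet> (hat (BJ (Suc j) *v (BX (Suc j) s *v y - z)) *v v q qd j)
        + u * (2 * (Phi (Suc j) \<bullet> (hat y *v (XJ (Suc j) s *v (XJ0 (Suc j) *v v q qd j)))))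
        + u * u * (Phi (Suc j) \<bullet> (hat y *v Phi (Suc j)))"
  using inner_hat_commute[of "XJ (Suc j) s *v (XJ0 (Suc j) *v v q qd j)" y "Phi (Suc j)"]
    inner_hat_joint[OF assms, of s "v q qd j" y "v q qd j"]
    inner_hat_diff[of "v q qd j" "BJ (Suc j)" "BX (Suc j) s *v y" "v q qd j" z]
  unfolding v_Suc_fun_upd
  by (simp add: matrix_vector_right_distrib matrix_vector_mult_scaleR inner_add_left inner_add_right
      algebra_simps)

lemma gravity_step_expansion:
  assumes "Suc j \<le> N"
  shows "v (q(Suc j := s)) (qd(Suc j := u)) (Suc j) \<bullet> (hat y *v g (q(Suc j := s)) (Suc j))
        - v q qd j \<bullet> (hat (BJ (Suc j) *v z) *v g q j)
      = v q qd j \<bullet> (hat (BJ (Suc j) *v (BX (Suc j) s *v y - z)) *v g q j)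
        + u * (Phi (Suc j) \<bullet> (hat y *v (XJ (Suc j) s *v (XJ0 (Suc j) *v g q j))))"
  using inner_hat_joint[OF assms, of s "v q qd j" y "g q j"]
    inner_hat_diff[of "v q qd j" "BJ (Suc j)" "BX (Suc j) s *v y" "g q j" z]
  unfolding v_Suc_fun_upd g_Suc_fun_upd
  by (simp add: matrix_vector_right_distrib matrix_vector_mult_scaleR inner_add_left inner_add_right
      algebra_simps)

lemma step_invisible_iff:
  assumes jN: "Suc j \<le> N"
  shows "(\<forall>q qd.
            v q qd (Suc j) \<bullet> (hat y *v v q qd (Suc j)) - v q qd j \<bullet> (hat (BJ (Suc j) *v z) *v v q qd j) = 0
          \<and> v q qd (Suc j) \<bullet> (hat y *v g q (Suc j)) - v q qd j \<bullet> (hat (BJ (Suc j) *v z) *v g q j) = 0)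
     \<longleftrightarrow> motion_orthogonal (Suc j) (hat y *v Phi (Suc j))
         \<and> (\<forall>s. param_invisible j (BJ (Suc j) *v (BX (Suc j) s *v y - z)))"
    (is "?lhs \<longleftrightarrow> _")
proof -
  let ?P = "Phi (Suc j)" and ?W = "\<lambda>s w. XJ (Suc j) s *v (XJ0 (Suc j) *v w)"
    and ?d = "\<lambda>s. BJ (Suc j) *v (BX (Suc j) s *v y - z)"
  \<comment> \<open>freeze all joints but the last one; the conditions become polynomial in its velocity\<close>
  have "?lhs \<longleftrightarrow> (\<forall>q qd s.
        (\<forall>u. v q qd j \<bullet> (hat (?d s) *v v q qd j) + u * (2 * (?P \<bullet> (hat y *v ?W s (v q qd j))))
            + u * u * (?P \<bullet> (hat y *v ?P)) = 0)
      \<and> (\<forall>u. v q qd j \<bullet> (hat (?d s) *v g q j) + u * (?P \<bullet> (hat y *v ?W s (g q j))) = 0))"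
    by (subst all_fun_upd_iff[where m="Suc j"])
       (simp only: vel_fun_upd_below Xto0_fun_upd_below lessI
         kinetic_step_expansion[OF jN] gravity_step_expansion[OF jN], blast)
  also have "\<dots> \<longleftrightarrow> (\<forall>q qd s. v q qd j \<bullet> (hat (?d s) *v v q qd j) = 0
      \<and> ?P \<bullet> (hat y *v ?W s (v q qd j)) = 0 \<and> ?P \<bullet> (hat y *v ?P) = 0
      \<and> v q qd j \<bullet> (hat (?d s) *v g q j) = 0 \<and> ?P \<bullet> (hat y *v ?W s (g q j)) = 0)"
    unfolding quadratic_eq_0_iff affine_eq_0_iff by simp
  also have "\<dots> \<longleftrightarrow> (?P \<bullet> (hat y *v ?P) = 0
      \<and> (\<forall>s q qd. ?P \<bullet> (hat y *v ?W s (v q qd j)) = 0 \<and> ?P \<bullet> (hat y *v ?W s (g q j)) = 0))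
      \<and> (\<forall>s. param_invisible j (?d s))"
    unfolding param_invisible_def by blast
  also have "\<dots> \<longleftrightarrow> motion_orthogonal (Suc j) (hat y *v ?P) \<and> (\<forall>s. param_invisible j (?d s))"
  proof -
    have "(hat y *v ?P) \<bullet> w = ?P \<bullet> (hat y *v w)" for w
      by (metis inner_hat_commute inner_commute)
    then show ?thesis
      unfolding motion_orthogonal_Suc_iff motion_orthogonal_def[of j] by (simp add: dot_lmul_matrix)
  qed
  finally show ?thesis .
qed

lemma hat_Phi_orthogonal_iff_Cmat: "Suc j \<le> N \<Longrightarrow>
   motion_orthogonal (Suc j) (hat y *v Phi (Suc j)) \<longleftrightarrow>
   (\<forall>r\<in>set (Cmat (Vt XJ0 Phi ag (Suc j)) (Phi (Suc j))). r \<bullet> y = 0)"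
  unfolding motion_orthogonal_iff_Vt Cmat_orthogonal_iff by (simp add: inner_commute)

lemma param_invisible_iff_Ct:
  "j \<le> N \<Longrightarrow> param_invisible j y \<longleftrightarrow> (\<forall>r\<in>set (Ct XJ0 Phi ag j). r \<bullet> y = 0)"
proof (induction j arbitrary: y)
  case 0 then show ?case by (simp add: param_invisible_def)
next
  case (Suc j)
  interpret J: joint "Phi (Suc j)" "XJ (Suc j)" using joint_at Suc.prems by simp
  have "param_invisible (Suc j) y \<longleftrightarrow> motion_orthogonal (Suc j) (hat y *v Phi (Suc j))
      \<and> (\<forall>s. param_invisible j (BJ (Suc j) *v (BX (Suc j) s *v y)))"
    using step_invisible_iff[OF Suc.prems, of y 0] by (simp add: param_invisible_def hat_zero)
  also have "\<dots> \<longleftrightarrow> (\<forall>r\<in>set (Cmat (Vt XJ0 Phi ag (Suc j)) (Phi (Suc j))). r \<bullet> y = 0) \<and>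
      (\<forall>r\<in>set (Ct XJ0 Phi ag j). \<forall>s. (r v* BJ (Suc j)) \<bullet> (BX (Suc j) s *v y) = 0)"
    using Suc by (auto simp: hat_Phi_orthogonal_iff_Cmat inner_matrix_vector_mult)
  also have "\<dots> \<longleftrightarrow> (\<forall>r\<in>set (Cmat (Vt XJ0 Phi ag (Suc j)) (Phi (Suc j))). r \<bullet> y = 0) \<and>
      (\<forall>r\<in>set (Omat XJ0 Phi (Ct XJ0 Phi ag j) (Suc j)). r \<bullet> y = 0)"
    unfolding Omat_orthogonal_iff J.Bmat_joint_orthogonal_iff ..
  finally show ?case by (simp only: Ct.simps set_append ball_Un)
qed

end


section \<open>Decomposition of the invisible parameter changes\<close>

lemma sum_triangular_eq_0_imp_eq_0:
  fixes F :: "nat \<Rightarrow> (nat \<Rightarrow> real) \<Rightarrow> (nat \<Rightarrow> real) \<Rightarrow> real"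
  assumes total: "\<And>q qd. (\<Sum>i=1..N. F i q qd) = 0"
    and local: "\<And>i m a b q qd. i < m \<Longrightarrow> F i (q(m := a)) (qd(m := b)) = F i q qd"
    and at_rest: "\<And>i q qd. i \<in> {1..N} \<Longrightarrow> F i (q(i := 0)) (qd(i := 0)) = 0"
    and i: "i \<in> {1..N}"
  shows "F i q qd = 0"
proof -
  have partial: "(\<Sum>i=1..m. F i q qd) = 0" if "m \<le> N" for m q qd
    using that
  proof (induction "N - m" arbitrary: m q qd)
    case 0 then show ?case using total by simp
  next
    case (Suc d)
    then have mN: "Suc m \<le> N" by simp
    \<comment> \<open>the terms below \<open>m+1\<close> do not see joint \<open>m+1\<close>, so freeze it\<close>
    have "(\<Sum>i=1..m. F i q qd) = (\<Sum>i=1..m. F i (q(Suc m := 0)) (qd(Suc m := 0)))"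
      by (rule sum.cong) (auto simp: local)
    also have "\<dots> = (\<Sum>i=1..Suc m. F i (q(Suc m := 0)) (qd(Suc m := 0)))"
      using at_rest[of "Suc m"] mN by simp
    also have "\<dots> = 0" using Suc(1)[of "Suc m"] Suc(2) mN by simp
    finally show ?case .
  qed
  obtain j where j: "i = Suc j" "Suc j \<le> N" using i by (cases i) auto
  have "F i q qd = (\<Sum>k=1..Suc j. F k q qd) - (\<Sum>k=1..j. F k q qd)" using j by simp
  then show ?thesis using partial[of "Suc j"] partial[of j] j by simp
qed

text \<open>The guard \<open>2 \<le> i\<close> keeps the ground, body \<open>0\<close>, free of parameters.\<close>

definition pair_param :: "(nat \<Rightarrow> real^10^10) \<Rightarrow> nat \<Rightarrow> real^10 \<Rightarrow> nat \<Rightarrow> real^10" where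
  "pair_param B i x = (\<lambda>j. if j = i then x else if j = i - 1 \<and> 2 \<le> i then - (B i *v x) else 0)"

lemma pair_param_split:
  "pair_param B i x j = (if j = i then x else 0) + (if i = Suc j \<and> 1 \<le> j then - (B i *v x) else 0)"
  unfolding pair_param_def by auto

lemma sum_pair_param: "(\<Sum>i=1..N. pair_param B i (x i) j) =
   (if 1 \<le> j \<and> j \<le> N then x j else 0) + (if 1 \<le> j \<and> Suc j \<le> N then - (B (Suc j) *v x (Suc j)) else 0)"
proof -
  have "(\<Sum>i=1..N. pair_param B i (x i) j) = (\<Sum>i=1..N. (if j = i then x i else 0)) +
        (\<Sum>i=1..N. (if i = Suc j then (if 1 \<le> j then - (B i *v x i) else 0) else 0))"
    unfolding pair_param_split sum.distrib by (intro arg_cong2[where f="(+)"] sum.cong) auto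
  then show ?thesis by (simp add: sum.delta sum.delta')
qed

lemma sum_linear_pair_param:
  assumes K: "\<And>j. linear (K j)" and K0: "\<And>y. K 0 y = 0"
  shows "(\<Sum>j=1..N. K j (\<Sum>i=1..N. pair_param B i (x i) j)) = (\<Sum>i=1..N. K i (x i) - K (i - 1) (B i *v x i))"
proof -
  have "(\<Sum>j=1..N. K j (\<Sum>i=1..N. pair_param B i (x i) j)) = (\<Sum>j=1..N. \<Sum>i=1..N. K j (pair_param B i (x i) j))"
    by (simp add: linear_sum[OF K])
  also have "\<dots> = (\<Sum>i=1..N. \<Sum>j=1..N. K j (pair_param B i (x i) j))"
    by (rule sum.swap)
  also have "\<dots> = (\<Sum>i=1..N. K i (x i) - K (i - 1) (B i *v x i))"
  proof (rule sum.cong[OF refl])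
    fix i assume i: "i \<in> {1..N}"
    have "(\<Sum>j=1..N. K j (pair_param B i (x i) j)) = (\<Sum>j=1..N. (if j = i then K j (x i) else 0))
        + (\<Sum>j=1..N. (if j = i - 1 then (if 1 \<le> j then - K j (B i *v x i) else 0) else 0))"
      unfolding sum.distrib[symmetric] pair_param_split
      by (rule sum.cong) (use i in \<open>auto simp: linear_add[OF K] linear_neg[OF K] linear_0[OF K]\<close>)
    also have "\<dots> = K i (x i) - K (i - 1) (B i *v x i)"
      using i by (cases "i = 1") (simp_all add: sum.delta' K0, arith)
    finally show "(\<Sum>j=1..N. K j (pair_param B i (x i) j)) = K i (x i) - K (i - 1) (B i *v x i)" .
  qed
  finally show ?thesis .
qed

text \<open>The unique components of \<open>\<delta>\<pi>\<close> as a sum of \<open>pair_param\<close>s, solved from the tip downwards.\<close>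

function lift_params :: "nat \<Rightarrow> (nat \<Rightarrow> real^10) \<Rightarrow> (nat \<Rightarrow> real^10^10) \<Rightarrow> nat \<Rightarrow> real^10" where
  "lift_params N dp B i = (if N \<le> i then dp i else dp i + B (Suc i) *v lift_params N dp B (Suc i))"
  by auto
termination by (relation "Wellfounded.measure (\<lambda>(N, dp, B, i). N - i)") auto

declare lift_params.simps [simp del]

lemma sum_pair_param_lift_params:
  assumes "dp \<in> Pspace N"
  shows "(\<Sum>i=1..N. pair_param B i (lift_params N dp B i) j) = dp j"
proof (cases "1 \<le> j \<and> j \<le> N")
  case True
  have "lift_params N dp B j = (if N \<le> j then dp j else dp j + B (Suc j) *v lift_params N dp B (Suc j))"
    by (rule lift_params.simps)
  then show ?thesis using True unfolding sum_pair_param by auto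
next
  case False
  then show ?thesis using assms unfolding sum_pair_param Pspace_def by auto
qed

context chain begin

definition kinetic_residual :: "nat \<Rightarrow> real^10 \<Rightarrow> (nat \<Rightarrow> real) \<Rightarrow> (nat \<Rightarrow> real) \<Rightarrow> real" where
  "kinetic_residual i x q qd =
     v q qd i \<bullet> (hat x *v v q qd i) - v q qd (i - 1) \<bullet> (hat (BJ i *v x) *v v q qd (i - 1))"

definition gravity_residual :: "nat \<Rightarrow> real^10 \<Rightarrow> (nat \<Rightarrow> real) \<Rightarrow> (nat \<Rightarrow> real) \<Rightarrow> real" where
  "gravity_residual i x q qd =
     v q qd i \<bullet> (hat x *v g q i) - v q qd (i - 1) \<bullet> (hat (BJ i *v x) *v g q (i - 1))"

lemma residuals_vanish_iff_Nmat:
  assumes i: "i \<in> {1..N}"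
  shows "(\<forall>q qd. kinetic_residual i x q qd = 0 \<and> gravity_residual i x q qd = 0)
     \<longleftrightarrow> (\<forall>r\<in>set (Nmat XJ0 Phi ag i). r \<bullet> x = 0)"
proof -
  obtain j where ij: "i = Suc j" and jN: "Suc j \<le> N" using i by (cases i) auto
  interpret J: joint "Phi (Suc j)" "XJ (Suc j)" using joint_at jN by simp
  have "(\<forall>q qd. kinetic_residual i x q qd = 0 \<and> gravity_residual i x q qd = 0)
      \<longleftrightarrow> motion_orthogonal (Suc j) (hat x *v Phi (Suc j))
         \<and> (\<forall>s. param_invisible j (BJ (Suc j) *v (BX (Suc j) s *v x - x)))"
    using step_invisible_iff[OF jN, of x x] by (simp add: kinetic_residual_def gravity_residual_def ij)
  also have "\<dots> \<longleftrightarrow> (\<forall>r\<in>set (Cmat (Vt XJ0 Phi ag (Suc j)) (Phi (Suc j))). r \<bullet> x = 0) \<and>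
      (\<forall>r\<in>set (Ct XJ0 Phi ag j). \<forall>s. (r v* BJ (Suc j)) \<bullet> (BX (Suc j) s *v x - x) = 0)"
    unfolding hat_Phi_orthogonal_iff_Cmat[OF jN] param_invisible_iff_Ct[OF Suc_leD[OF jN]]
    by (auto simp: inner_matrix_vector_mult)
  also have "\<dots> \<longleftrightarrow> (\<forall>r\<in>set (Cmat (Vt XJ0 Phi ag (Suc j)) (Phi (Suc j))). r \<bullet> x = 0) \<and>
      (\<forall>r\<in>set (Omat XJ0 Phi (Ct XJ0 Phi ag j) (Suc j)). r \<bullet> (Amat (Phi (Suc j)) *v x) = 0)"
    unfolding Omat_orthogonal_iff J.Bmat_joint_diff_orthogonal_iff ..
  also have "\<dots> \<longleftrightarrow> (\<forall>r\<in>set (Nmat XJ0 Phi ag i). r \<bullet> x = 0)"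
    unfolding Nmat_def ij set_append ball_Un by (simp add: dot_lmul_matrix)
  finally show ?thesis .
qed

lemma residuals_fun_upd_above:
  assumes "i < m"
  shows "kinetic_residual i x (q(m := a)) (qd(m := b)) = kinetic_residual i x q qd"
    and "gravity_residual i x (q(m := a)) (qd(m := b)) = gravity_residual i x q qd"
  using assms
  by (simp_all add: kinetic_residual_def gravity_residual_def vel_fun_upd_below Xto0_fun_upd_below)

lemma residuals_at_rest:
  assumes i: "i \<in> {1..N}"
  shows "kinetic_residual i x (q(i := 0)) (qd(i := 0)) = 0"
    and "gravity_residual i x (q(i := 0)) (qd(i := 0)) = 0"
proof -
  obtain j where ij: "i = Suc j" "Suc j \<le> N" using i by (cases i) auto
  have S: "is_stransform (XJ0 (Suc j))" using stransform ij by simp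
  have X0: "XJ (Suc j) 0 = mat 1" using joint_0 ij by simp
  have "v (q(i := 0)) (qd(i := 0)) i = XJ0 (Suc j) *v v q qd j"
    using v_Suc_fun_upd[of q j 0 qd 0] X0 by (simp add: ij)
  moreover have "g (q(i := 0)) i = XJ0 (Suc j) *v g q j"
    using g_Suc_fun_upd[of q j 0] X0 by (simp add: ij)
  moreover have "v (q(i := 0)) (qd(i := 0)) (i - 1) = v q qd j" by (simp add: ij vel_fun_upd_below)
  moreover have "g (q(i := 0)) (i - 1) = g q j" by (simp add: ij Xto0_fun_upd_below)
  ultimately show "kinetic_residual i x (q(i := 0)) (qd(i := 0)) = 0"
    and "gravity_residual i x (q(i := 0)) (qd(i := 0)) = 0"
    unfolding kinetic_residual_def gravity_residual_def
    by (simp_all add: ij inner_congruence hat_Bmat_stransform[OF S])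
qed

lemma kinetic_sum_pair_param:
  assumes "\<And>j. dp j = (\<Sum>i=1..N. pair_param BJ i (x i) j)"
  shows "(\<Sum>j=1..N. v q qd j \<bullet> (hat (dp j) *v v q qd j)) = (\<Sum>i=1..N. kinetic_residual i (x i) q qd)"
  unfolding assms kinetic_residual_def by (rule sum_linear_pair_param[OF linear_inner_hat]) simp

lemma gravity_sum_pair_param:
  assumes "\<And>j. dp j = (\<Sum>i=1..N. pair_param BJ i (x i) j)"
  shows "(\<Sum>j=1..N. v q qd j \<bullet> (hat (dp j) *v g q j)) = (\<Sum>i=1..N. gravity_residual i (x i) q qd)"
  unfolding assms gravity_residual_def by (rule sum_linear_pair_param[OF linear_inner_hat]) simp

lemma Tset_eq_pair_param:
  assumes i: "i \<in> {1..N}" and t: "t \<in> Tset N XJ0 Phi ag i"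
  shows "t = pair_param BJ i (t i)"
proof
  fix j
  have "t \<in> Pspace N" "i \<ge> 2 \<longrightarrow> t (i - 1) = - (BJ i *v t i)" "\<forall>j. j \<noteq> i \<and> j \<noteq> i - 1 \<longrightarrow> t j = 0"
    using t unfolding Tset_def by auto
  then show "t j = pair_param BJ i (t i) j"
    using i by (cases "j = i - 1") (auto simp: pair_param_def Pspace_def)
qed

lemma Tset_orthogonal_Nmat:
  "t \<in> Tset N XJ0 Phi ag i \<Longrightarrow> \<forall>r\<in>set (Nmat XJ0 Phi ag i). r \<bullet> t i = 0"
  unfolding Tset_def by blast

lemma pair_param_in_Tset:
  assumes "i \<in> {1..N}" and "\<forall>r\<in>set (Nmat XJ0 Phi ag i). r \<bullet> x = 0"
  shows "pair_param BJ i x \<in> Tset N XJ0 Phi ag i"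
  unfolding Tset_def Pspace_def using assms by (auto simp: pair_param_def)

lemma Tset_sum_in_Ngset:
  assumes t: "\<forall>i\<in>{1..N}. t i \<in> Tset N XJ0 Phi ag i"
  shows "(\<lambda>j. \<Sum>i=1..N. t i j) \<in> Ngset N XJ XJ0 Phi ag"
proof -
  have t_eq: "(\<Sum>i=1..N. t i j) = (\<Sum>i=1..N. pair_param BJ i (t i i) j)" for j
    using Tset_eq_pair_param t by (intro sum.cong refl) metis
  have res: "kinetic_residual i (t i i) q qd = 0 \<and> gravity_residual i (t i i) q qd = 0"
    if "i \<in> {1..N}" for i q qd
    using residuals_vanish_iff_Nmat[OF that] Tset_orthogonal_Nmat t that by blast
  have "(\<lambda>j. \<Sum>i=1..N. t i j) \<in> Pspace N"
    using t unfolding Tset_def Pspace_def by auto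
  then show ?thesis
    unfolding Ngset_def
    using kinetic_sum_pair_param[of "\<lambda>j. \<Sum>i=1..N. t i j", OF t_eq]
      gravity_sum_pair_param[of "\<lambda>j. \<Sum>i=1..N. t i j", OF t_eq] res
    by simp
qed

lemma Tset_sum_eq_0_imp_eq_0:
  assumes t: "\<forall>i\<in>{1..N}. t i \<in> Tset N XJ0 Phi ag i" and sum0: "(\<lambda>j. \<Sum>i=1..N. t i j) = (\<lambda>j. 0)"
  shows "\<forall>i\<in>{1..N}. t i = (\<lambda>j. 0)"
proof -
  have t_eq: "t i = pair_param BJ i (t i i)" if "i \<in> {1..N}" for i
    using Tset_eq_pair_param t that by blast
  have eq: "(if 1 \<le> j \<and> j \<le> N then t j j else 0)
      + (if 1 \<le> j \<and> Suc j \<le> N then - (BJ (Suc j) *v t (Suc j) (Suc j)) else 0) = 0" for j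
  proof -
    have "(\<Sum>i=1..N. t i j) = (\<Sum>i=1..N. pair_param BJ i (t i i) j)"
      using t_eq by (intro sum.cong refl) metis
    then have "(\<Sum>i=1..N. pair_param BJ i (t i i) j) = 0"
      using fun_cong[OF sum0, of j] by simp
    then show ?thesis unfolding sum_pair_param .
  qed
  have "t j j = 0" if "j \<le> N" "1 \<le> j" for j
    using that
  proof (induction "N - j" arbitrary: j)
    case 0 then show ?case using eq[of j] by simp
  next
    case (Suc d)
    then have jN: "Suc j \<le> N" by simp
    then have "t (Suc j) (Suc j) = 0" using Suc(1)[of "Suc j"] Suc(2) by simp
    then show ?case using eq[of j] jN Suc.prems by simp
  qed
  then show ?thesis using t_eq by (auto simp: pair_param_def fun_eq_iff)
qed

lemma Ngset_decomposition:
  assumes dp: "dp \<in> Ngset N XJ XJ0 Phi ag"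
  shows "\<exists>t. dp = (\<lambda>j. \<Sum>i=1..N. t i j) \<and> (\<forall>i\<in>{1..N}. t i \<in> Tset N XJ0 Phi ag i)"
proof -
  have P: "dp \<in> Pspace N" using dp unfolding Ngset_def by blast
  define x where "x i = lift_params N dp BJ i" for i
  have dp_eq: "dp j = (\<Sum>i=1..N. pair_param BJ i (x i) j)" for j
    unfolding x_def using sum_pair_param_lift_params[OF P] by simp
  have K: "(\<Sum>i=1..N. kinetic_residual i (x i) q qd) = 0"
    and G: "(\<Sum>i=1..N. gravity_residual i (x i) q qd) = 0" for q qd
    using dp kinetic_sum_pair_param[OF dp_eq] gravity_sum_pair_param[OF dp_eq]
    unfolding Ngset_def by auto
  have "\<forall>r\<in>set (Nmat XJ0 Phi ag i). r \<bullet> x i = 0" if i: "i \<in> {1..N}" for i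
    unfolding residuals_vanish_iff_Nmat[OF i, symmetric]
    using sum_triangular_eq_0_imp_eq_0[where F="\<lambda>i. kinetic_residual i (x i)", OF K
          residuals_fun_upd_above(1) residuals_at_rest(1) i]
      sum_triangular_eq_0_imp_eq_0[where F="\<lambda>i. gravity_residual i (x i)", OF G
          residuals_fun_upd_above(2) residuals_at_rest(2) i]
    by blast
  then have "\<forall>i\<in>{1..N}. pair_param BJ i (x i) \<in> Tset N XJ0 Phi ag i"
    using pair_param_in_Tset by blast
  moreover have "dp = (\<lambda>j. \<Sum>i=1..N. pair_param BJ i (x i) j)" using dp_eq by blast
  ultimately show ?thesis by (intro exI[of _ "\<lambda>i. pair_param BJ i (x i)"]) simp
qed

end

theorem mainTheorem8:
  fixes N :: nat
    and XJ :: "nat \<Rightarrow> real \<Rightarrow> real^6^6"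
    and XJ0 :: "nat \<Rightarrow> real^6^6"
    and Phi :: "nat \<Rightarrow> real^6"
    and ag :: "real^6"
  assumes "\<forall>i\<in>{1..N}. is_stransform (XJ0 i)"
    and "\<forall>i\<in>{1..N}. XJ i 0 = mat 1"
    and "\<forall>i\<in>{1..N}. \<forall>q. (XJ i has_vector_derivative (- (scross (Phi i) ** XJ i q))) (at q)"
    and "topv ag = 0"
  shows "is_direct_sum (Ngset N XJ XJ0 Phi ag) N (Tset N XJ0 Phi ag)"
proof -
  interpret chain N XJ XJ0 Phi ag using assms(1-3) by unfold_locales
  show ?thesis
    unfolding is_direct_sum_def
    using Ngset_decomposition Tset_sum_in_Ngset Tset_sum_eq_0_imp_eq_0 by blast
qed

end
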